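(* Let $\mu$ be a finite measure in $\mathbb{R}^N$. Then $\mu$ is a charge if and only if for every Borel set $A \subset \mathbb{R}^N$, $\mathcal{H}^{N-1}(A) < +\infty$ implies $\mu(A) = 0$.
   Context: $N\ge1$ is an integer. A finite measure in $\mathbb{R}^N$ is a finite signed Borel measure (not necessarily nonnegative). A finite measure $\mu$ is a charge if for every $\epsilon > 0$ and for every compact set $K \subset \mathbb{R}^N$ there exists $C > 0$ such that for every $\varphi \in C_c^\infty(\mathbb{R}^N)$ supported in $K$, $$\Bigl|\int_{\mathbb{R}^N} \varphi \, d\mu\Bigr| \le C \|\varphi\|_{L^1(\mathbb{R}^N)} + \epsilon\bigl(\|D\varphi\|_{L^1(\mathbb{R}^N)} + \|\varphi\|_{L^\infty(\mathbb{R}^N)}\bigr).$$ $\mathcal{H}^{N-1}$ is the (spherical) Hausdorff measure of dimension $s=N-1$: $\mathcal{H}^{s}(A) = \lim_{\delta\to 0} \inf\{\sum_{n=0}^\infty \omega_s r_n^s : A \subset \bigcup_{n=0}^\infty B(x_n;r_n),\ 0\le r_n \le \delta\}$ with $\omega_s = \pi^{s/2}/\Gamma(\frac{s}{2}+1)$ and $B(x;r)$ the ball of center $x$ and radius $r$ (for $s=0$, $\mathcal{H}^0$ is the counting measure). *)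

theory Defs
  imports "HOL-Analysis.Analysis" "HOL-Probability.Essential_Supremum"
begin

text \<open>
  A finite signed Borel measure is a set function that is countably additive on the Borel sets;
  its values on other sets are irrelevant.
\<close>

definition finite_signed_borel_measure :: "('a::topological_space set \<Rightarrow> real) \<Rightarrow> bool" where
  "finite_signed_borel_measure \<mu> \<longleftrightarrow>
     \<mu> {} = 0 \<and>
     (\<forall>A :: nat \<Rightarrow> 'a set. range A \<subseteq> sets borel \<longrightarrow> disjoint_family A \<longrightarrow>
        (\<lambda>i. \<mu> (A i)) sums \<mu> (\<Union>i. A i))"

text \<open>
  The two parts of the Jordan decomposition. In \<open>pos_part_measure\<close> the coercion
  \<^const>\<open>ennreal\<close> sends negative values to 0, which does not affect the supremum since
  the empty set is among the competitors.
\<close>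

definition pos_part_measure :: "('a::topological_space set \<Rightarrow> real) \<Rightarrow> 'a measure" where
  "pos_part_measure \<mu> =
     measure_of UNIV (sets borel) (\<lambda>A. SUP B\<in>{B \<in> sets borel. B \<subseteq> A}. ennreal (\<mu> B))"

definition neg_part_measure :: "('a::topological_space set \<Rightarrow> real) \<Rightarrow> 'a measure" where
  "neg_part_measure \<mu> = pos_part_measure (\<lambda>A. - \<mu> A)"

definition signed_integral ::
    "('a::topological_space set \<Rightarrow> real) \<Rightarrow> ('a \<Rightarrow> real) \<Rightarrow> real" where
  "signed_integral \<mu> f =
     integral\<^sup>L (pos_part_measure \<mu>) f - integral\<^sup>L (neg_part_measure \<mu>) f"

fun C_k :: "nat \<Rightarrow> ('a::euclidean_space \<Rightarrow> real) \<Rightarrow> bool" where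
  "C_k 0 f \<longleftrightarrow> continuous_on UNIV f"
| "C_k (Suc k) f \<longleftrightarrow>
     (\<forall>x. f differentiable (at x)) \<and> (\<forall>v. C_k k (\<lambda>x. frechet_derivative f (at x) v))"

definition smooth :: "('a::euclidean_space \<Rightarrow> real) \<Rightarrow> bool" where
  "smooth f \<longleftrightarrow> (\<forall>k. C_k k f)"

definition supp :: "('a::euclidean_space \<Rightarrow> real) \<Rightarrow> 'a set" where
  "supp f = closure {x. f x \<noteq> 0}"

definition L1_norm :: "('a::euclidean_space \<Rightarrow> real) \<Rightarrow> real" where
  "L1_norm f = (LINT x|lborel. \<bar>f x\<bar>)"

text \<open>The operator norm of the derivative at a point is the Euclidean norm of the gradient there.\<close>

definition L1_norm_deriv :: "('a::euclidean_space \<Rightarrow> real) \<Rightarrow> real" where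
  "L1_norm_deriv f = (LINT x|lborel. onorm (frechet_derivative f (at x)))"

definition Linf_norm :: "('a::euclidean_space \<Rightarrow> real) \<Rightarrow> real" where
  "Linf_norm f = real_of_ereal (esssup lborel (\<lambda>x. ereal \<bar>f x\<bar>))"

definition charge :: "('a::euclidean_space set \<Rightarrow> real) \<Rightarrow> bool" where
  "charge \<mu> \<longleftrightarrow>
     (\<forall>\<epsilon>>0. \<forall>K. compact K \<longrightarrow>
       (\<exists>C>0. \<forall>\<phi>. smooth \<phi> \<longrightarrow> supp \<phi> \<subseteq> K \<longrightarrow>
          \<bar>signed_integral \<mu> \<phi>\<bar>
            \<le> C * L1_norm \<phi> + \<epsilon> * (L1_norm_deriv \<phi> + Linf_norm \<phi>)))"

text \<open>
  For \<open>s = 0\<close> it matters that balls are open and that \<open>0 powr 0 = 0\<close>: a ball of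
  radius 0 is empty and costs nothing, so that finite covers are allowed and the Hausdorff
  measure of dimension 0 is the counting measure.
\<close>

definition hausdorff_content :: "real \<Rightarrow> real \<Rightarrow> 'a::metric_space set \<Rightarrow> ennreal" where
  "hausdorff_content s \<delta> A =
     Inf {(\<Sum>n. ennreal (unit_ball_vol s * r n powr s)) | (x :: nat \<Rightarrow> 'a) (r :: nat \<Rightarrow> real).
            A \<subseteq> (\<Union>n. ball (x n) (r n)) \<and> (\<forall>n. 0 \<le> r n \<and> r n \<le> \<delta>)}"

definition hausdorff_measure :: "real \<Rightarrow> 'a::metric_space set \<Rightarrow> ennreal" where
  "hausdorff_measure s A = Lim (at_right 0) (\<lambda>\<delta>. hausdorff_content s \<delta> A)"

end

theory Submission
  imports Defs
begin

text \<open>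
  Suppose \<open>\<mu>\<close> vanishes on the sets of finite Hausdorff measure. For each \<open>a > 0\<close> the points lying
  in arbitrarily small dyadic cubes \<open>Q\<close> of side \<open>l\<close> with \<open>\<bar>\<mu>\<bar>(Q) > a l\<^sup>N\<^sup>-\<^sup>1\<close> form such a set, since
  the maximal ones among these cubes are disjoint. Hence, up to small mass, \<open>\<bar>\<mu>\<bar>(Q) \<le> a l\<^sup>N\<^sup>-\<^sup>1\<close> for
  all small cubes. A measure \<open>\<nu>\<close> with this growth satisfies
  \<open>\<integral>\<bar>\<phi>\<bar> d\<nu> \<le> c a \<parallel>D\<phi>\<parallel>\<^sub>1 + C \<parallel>\<phi>\<parallel>\<^sub>1\<close>: by a boxing argument each superlevel set \<open>E\<close> of \<open>\<bar>\<phi>\<bar>\<close> is covered by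
  disjoint dyadic cubes in which both \<open>E\<close> and its complement have a fixed proportion of the volume, so
  the relative isoperimetric inequality bounds \<open>\<Sum> l\<^sup>N\<^sup>-\<^sup>1\<close> by the perimeter of \<open>E\<close>, and one integrates
  over the levels. Perimeters are replaced throughout by averages over small \<open>k\<close> of the volume of
  \<open>{z. (z \<in> E) \<noteq> (z + k \<in> E)}\<close>, rescaled; then the coarea formula is Fubini's theorem.

  Conversely, let \<open>\<mu>\<close> be a charge and \<open>L\<close> a compact set of finite Hausdorff measure. Covering \<open>L\<close> by
  finitely many small balls and gluing bump functions gives test functions \<open>\<phi>\<close> that are bounded
  below on \<open>L\<close>, live near \<open>L\<close>, have bounded \<open>\<parallel>D\<phi>\<parallel>\<^sub>1\<close> and satisfy \<open>\<parallel>\<phi>\<parallel>\<^sub>1 \<rightarrow> 0\<close>. The charge estimate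
  then bounds the positive part of \<open>\<mu>\<close> on \<open>L\<close> by a multiple of its negative part.
\<close>

section \<open>Jordan decomposition\<close>

lemma ennreal_add_le: "ennreal (a + b) \<le> ennreal a + ennreal b"
proof (cases "0 \<le> a \<and> 0 \<le> b")
  case False
  then have "ennreal (a + b) \<le> ennreal a \<or> ennreal (a + b) \<le> ennreal b"
    by (auto intro!: ennreal_leI)
  then show ?thesis by (auto intro: add_increasing add_increasing2)
qed simp

lemma ennreal_sum_le: "ennreal (\<Sum>i<(n::nat). f i) \<le> (\<Sum>i<n. ennreal (f i))"
proof (induction n)
  case (Suc n)
  have "ennreal (\<Sum>i<Suc n. f i) \<le> ennreal (\<Sum>i<n. f i) + ennreal (f n)"
    using ennreal_add_le by simp
  also have "\<dots> \<le> (\<Sum>i<Suc n. ennreal (f i))"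
    using Suc by (simp add: add_right_mono)
  finally show ?case .
qed simp

context
  fixes \<mu> :: "'a::topological_space set \<Rightarrow> real"
  assumes \<mu>: "finite_signed_borel_measure \<mu>"
begin

lemma signed_measure_empty: "\<mu> {} = 0"
  using \<mu> unfolding finite_signed_borel_measure_def by blast

lemma signed_measure_sums:
  assumes "\<And>i. A i \<in> sets borel" "disjoint_family A"
  shows "(\<lambda>i::nat. \<mu> (A i)) sums \<mu> (\<Union>i. A i)"
  using \<mu> assms unfolding finite_signed_borel_measure_def by blast

lemma signed_measure_Un:
  assumes "A \<in> sets borel" "B \<in> sets borel" "A \<inter> B = {}"
  shows "\<mu> (A \<union> B) = \<mu> A + \<mu> B"
proof -
  have "(\<lambda>i. \<mu> (binaryset A B i)) sums \<mu> (\<Union>i. binaryset A B i)"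
    using assms by (intro signed_measure_sums) (auto simp: binaryset_def disjoint_family_on_def)
  moreover have "(\<lambda>i. \<mu> (binaryset A B i)) sums (\<mu> A + \<mu> B)"
    by (rule binaryset_sums) (rule signed_measure_empty)
  ultimately show ?thesis
    by (simp add: UN_binaryset_eq sums_iff)
qed

lemma signed_measure_Diff:
  assumes "A \<in> sets borel" "B \<in> sets borel" "B \<subseteq> A"
  shows "\<mu> (A - B) = \<mu> A - \<mu> B"
proof -
  have "\<mu> ((A - B) \<union> B) = \<mu> (A - B) + \<mu> B"
    using assms by (intro signed_measure_Un) auto
  moreover have "(A - B) \<union> B = A" using assms(3) by auto
  ultimately show ?thesis by simp
qed

text \<open>Otherwise a Borel set on which \<open>\<mu>\<close> is unbounded can be split again and
  again, keeping a half on which it is unbounded and discarding one with absolute value at least 1.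
  The discarded pieces are disjoint, so their values would form a convergent series whose terms do
  not tend to 0.\<close>

lemma signed_measure_bounded: "\<exists>M. \<forall>B\<in>sets borel. \<bar>\<mu> B\<bar> \<le> M"
proof (rule ccontr)
  define unb where "unb X \<longleftrightarrow> X \<in> sets borel \<and> (\<forall>M. \<exists>B\<in>sets borel. B \<subseteq> X \<and> \<bar>\<mu> B\<bar> > M)" for X
  assume "\<not> ?thesis"
  then have 0: "unb UNIV" unfolding unb_def by (auto simp: not_le)
  have step: "\<exists>Y. unb Y \<and> Y \<subseteq> X \<and> \<bar>\<mu> (X - Y)\<bar> \<ge> 1" if X: "unb X" for X
  proof -
    \<comment> \<open>With the margin \<open>\<bar>\<mu> X\<bar> + 1\<close> both \<open>B\<close>
      and \<open>X - B\<close> have absolute value above 1, so either of them may be the discarded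
      half.\<close>
    obtain B where B: "B \<in> sets borel" "B \<subseteq> X" "\<bar>\<mu> B\<bar> > \<bar>\<mu> X\<bar> + 1"
      using X unfolding unb_def by blast
    have Xm: "X \<in> sets borel" using X unb_def by blast
    have d: "\<mu> (X - B) = \<mu> X - \<mu> B" by (rule signed_measure_Diff[OF Xm B(1,2)])
    have dB: "X - (X - B) = B" using B by auto
    have "unb B \<or> unb (X - B)"
    proof (rule ccontr)
      assume "\<not> ?thesis"
      then have nub: "\<not> unb B" "\<not> unb (X - B)" by auto
      obtain M1 where M1: "\<And>C. C \<in> sets borel \<Longrightarrow> C \<subseteq> B \<Longrightarrow> \<bar>\<mu> C\<bar> \<le> M1"
        using nub(1) B unfolding unb_def by (meson not_less)
      have "X - B \<in> sets borel" using Xm B by auto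
      then obtain M2 where M2: "\<And>C. C \<in> sets borel \<Longrightarrow> C \<subseteq> X - B \<Longrightarrow> \<bar>\<mu> C\<bar> \<le> M2"
        using nub(2) unfolding unb_def by (meson not_less)
      obtain C where C: "C \<in> sets borel" "C \<subseteq> X" "\<bar>\<mu> C\<bar> > M1 + M2"
        using X unfolding unb_def by blast
      have "\<mu> ((C \<inter> B) \<union> (C - B)) = \<mu> (C \<inter> B) + \<mu> (C - B)"
        using C B by (intro signed_measure_Un) auto
      moreover have "(C \<inter> B) \<union> (C - B) = C" by auto
      moreover have "\<bar>\<mu> (C \<inter> B)\<bar> \<le> M1" using C B by (intro M1) auto
      moreover have "\<bar>\<mu> (C - B)\<bar> \<le> M2" using C B by (intro M2) auto
      ultimately show False using C(3) by simp
    qed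
    then show ?thesis
    proof
      assume "unb B"
      then show ?thesis using B d by (intro exI[of _ B]) auto
    next
      assume "unb (X - B)"
      then show ?thesis using B d dB by (intro exI[of _ "X - B"]) auto
    qed
  qed
  obtain Y where Y: "\<And>n. unb (Y n)" "\<And>n. Y (Suc n) \<subseteq> Y n" "\<And>n. \<bar>\<mu> (Y n - Y (Suc n))\<bar> \<ge> 1"
    using dependent_nat_choice[of "\<lambda>_. unb" "\<lambda>_ X Y. Y \<subseteq> X \<and> \<bar>\<mu> (X - Y)\<bar> \<ge> 1"] 0 step by metis
  have Ym: "Y n \<in> sets borel" for n using Y(1) unb_def by blast
  have dec: "decseq Y" using Y(2) by (rule decseq_SucI)
  have disj: "(Y m - Y (Suc m)) \<inter> (Y n - Y (Suc n)) = {}" if "m < n" for m n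
    using decseqD[OF dec, of "Suc m" n] that by auto
  have "(\<lambda>n. \<mu> (Y n - Y (Suc n))) sums \<mu> (\<Union>n. Y n - Y (Suc n))"
  proof (rule signed_measure_sums)
    show "disjoint_family (\<lambda>n. Y n - Y (Suc n))"
      unfolding disjoint_family_on_def
      using disj by (metis inf_commute linorder_neqE_nat)
  qed (use Ym in auto)
  then have "(\<lambda>n. \<mu> (Y n - Y (Suc n))) \<longlonglongrightarrow> 0"
    using sums_summable summable_LIMSEQ_zero by blast
  then obtain n where "\<bar>\<mu> (Y n - Y (Suc n))\<bar> < 1"
    unfolding lim_sequentially by (force dest: spec[of _ 1])
  with Y(3)[of n] show False by simp
qed

lemma finite_signed_borel_measure_uminus: "finite_signed_borel_measure (\<lambda>A. - \<mu> A)"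
  using \<mu> unfolding finite_signed_borel_measure_def by (auto intro: sums_minus)

abbreviation (input) posv :: "'a set \<Rightarrow> ennreal" where
  "posv A \<equiv> (SUP B\<in>{B \<in> sets borel. B \<subseteq> A}. ennreal (\<mu> B))"

lemma posv_mono: "A \<subseteq> B \<Longrightarrow> posv A \<le> posv B"
  by (rule SUP_subset_mono) auto

text \<open>The union of a competitor in \<open>A\<close> and one in \<open>B\<close> competes in
  \<open>A \<union> B\<close>. A competitor of negative value is dropped instead, as
  \<open>ennreal\<close> already counts it as 0.\<close>

lemma posv_Un:
  assumes "A \<inter> B = {}"
  shows "posv A + posv B \<le> posv (A \<union> B)"
proof -
  have *: "ennreal (\<mu> X) + ennreal (\<mu> Y) \<le> posv (A \<union> B)"
    if "X \<in> sets borel" "X \<subseteq> A" "Y \<in> sets borel" "Y \<subseteq> B" for X Y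
  proof -
    consider "\<mu> X \<le> 0" | "\<mu> Y \<le> 0" | "\<mu> X \<ge> 0" "\<mu> Y \<ge> 0" by linarith
    then show ?thesis
    proof cases
      case 1
      then have "ennreal (\<mu> X) + ennreal (\<mu> Y) = ennreal (\<mu> Y)" by (simp add: ennreal_neg)
      also have "\<dots> \<le> posv (A \<union> B)" using that by (intro SUP_upper) auto
      finally show ?thesis .
    next
      case 2
      then have "ennreal (\<mu> X) + ennreal (\<mu> Y) = ennreal (\<mu> X)" by (simp add: ennreal_neg)
      also have "\<dots> \<le> posv (A \<union> B)" using that by (intro SUP_upper) auto
      finally show ?thesis .
    next
      case 3
      have "X \<inter> Y = {}" using that assms by auto
      then have "ennreal (\<mu> X) + ennreal (\<mu> Y) = ennreal (\<mu> (X \<union> Y))"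
        using 3 signed_measure_Un[of X Y] that by simp
      also have "\<dots> \<le> posv (A \<union> B)" using that by (intro SUP_upper) auto
      finally show ?thesis .
    qed
  qed
  have ne: "{B \<in> sets borel. B \<subseteq> C} \<noteq> {}" for C :: "'a set" by auto
  have "posv A + posv B = (SUP X\<in>{X \<in> sets borel. X \<subseteq> A}. SUP Y\<in>{Y \<in> sets borel. Y \<subseteq> B}. ennreal (\<mu> X) + ennreal (\<mu> Y))"
    by (subst ennreal_SUP_add_left[OF ne, symmetric], rule SUP_cong, rule refl,
        subst ennreal_SUP_add_right[OF ne, symmetric], rule refl)
  also have "\<dots> \<le> posv (A \<union> B)"
    by (intro SUP_least) (use * in auto)
  finally show ?thesis .
qed

text \<open>Superadditivity on finite unions gives one inequality. For the other, a competitor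
  \<open>B\<close> is cut into the pieces \<open>B \<inter> A i\<close>, each of which competes in
  \<open>A i\<close>.\<close>

lemma countably_additive_posv: "countably_additive (sets borel) (\<lambda>A. posv A)"
proof (rule countably_additiveI)
  fix A :: "nat \<Rightarrow> 'a set"
  assume A: "range A \<subseteq> sets borel" "disjoint_family A"
  show "(\<Sum>i. posv (A i)) = posv (\<Union>i. A i)"
  proof (rule antisym)
    have "(\<Sum>i<n. posv (A i)) \<le> posv (\<Union>i<n. A i)" for n
    proof (induction n)
      case (Suc n)
      have "(\<Sum>i<Suc n. posv (A i)) \<le> posv (\<Union>i<n. A i) + posv (A n)"
        using Suc by (simp add: add_right_mono)
      also have "\<dots> \<le> posv ((\<Union>i<n. A i) \<union> A n)"
      proof (intro posv_Un)
        have "A i \<inter> A n = {}" if "i < n" for i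
          using disjoint_family_onD[OF A(2)] that by simp
        then show "(\<Union>i<n. A i) \<inter> A n = {}" by blast
      qed
      finally show ?case by (simp add: lessThan_Suc Un_commute)
    qed simp
    also have "posv (\<Union>i<n. A i) \<le> posv (\<Union>i. A i)" for n
      by (rule posv_mono) auto
    finally show "(\<Sum>i. posv (A i)) \<le> posv (\<Union>i. A i)"
      by (auto simp: suminf_eq_SUP intro: SUP_least)
  next
    show "posv (\<Union>i. A i) \<le> (\<Sum>i. posv (A i))"
    proof (rule SUP_least, clarify)
      fix B assume B: "B \<in> sets borel" "B \<subseteq> (\<Union>i. A i)"
      have "(\<lambda>i. \<mu> (B \<inter> A i)) sums \<mu> (\<Union>i. B \<inter> A i)"
        using A B by (intro signed_measure_sums) (auto simp: disjoint_family_on_def)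
      moreover have "(\<Union>i. B \<inter> A i) = B" using B by auto
      ultimately have "(\<lambda>n. ennreal (\<Sum>i<n. \<mu> (B \<inter> A i))) \<longlonglongrightarrow> ennreal (\<mu> B)"
        unfolding sums_def by (intro tendsto_ennrealI) simp
      moreover have "ennreal (\<Sum>i<n. \<mu> (B \<inter> A i)) \<le> (\<Sum>i. posv (A i))" for n
      proof -
        have "ennreal (\<Sum>i<n. \<mu> (B \<inter> A i)) \<le> (\<Sum>i<n. ennreal (\<mu> (B \<inter> A i)))"
          by (rule ennreal_sum_le)
        also have "\<dots> \<le> (\<Sum>i<n. posv (A i))"
          using A B by (intro sum_mono SUP_upper) auto
        also have "\<dots> \<le> (\<Sum>i. posv (A i))" by (rule sum_le_suminf) auto
        finally show ?thesis .
      qed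
      ultimately show "ennreal (\<mu> B) \<le> (\<Sum>i. posv (A i))"
        by (intro LIMSEQ_le_const2) auto
    qed
  qed
qed

lemma sets_pos_part_measure [simp]: "sets (pos_part_measure \<mu>) = sets borel"
  unfolding pos_part_measure_def
  by (metis sets.sigma_algebra_axioms sigma_algebra.sets_measure_of_eq space_borel)

lemma emeasure_pos_part_measure:
  assumes "A \<in> sets borel"
  shows "emeasure (pos_part_measure \<mu>) A = posv A"
  unfolding pos_part_measure_def
proof (rule emeasure_measure_of_sigma)
  show "sigma_algebra UNIV (sets (borel :: 'a measure))"
    by (metis sets.sigma_algebra_axioms space_borel)
  show "positive (sets borel) (\<lambda>A. posv A)"
    by (auto simp: positive_def signed_measure_empty)
qed (use assms countably_additive_posv in auto)

lemma finite_measure_pos_part_measure: "finite_measure (pos_part_measure \<mu>)"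
proof
  obtain M where M: "\<And>B. B \<in> sets borel \<Longrightarrow> \<bar>\<mu> B\<bar> \<le> M" using signed_measure_bounded by blast
  have "posv UNIV \<le> ennreal M"
    by (intro SUP_least ennreal_leI) (use M in force)
  then have "posv UNIV < \<infinity>" by (rule order.strict_trans1) simp
  moreover have "space (pos_part_measure \<mu>) = UNIV"
    using sets_eq_imp_space_eq[OF sets_pos_part_measure] by simp
  ultimately show "emeasure (pos_part_measure \<mu>) (space (pos_part_measure \<mu>)) \<noteq> \<infinity>"
    by (simp only: emeasure_pos_part_measure[OF borel_closed[OF closed_UNIV]])
qed

lemma measure_pos_part_le:
  assumes "A \<in> sets borel" "\<And>B. B \<in> sets borel \<Longrightarrow> B \<subseteq> A \<Longrightarrow> \<mu> B \<le> c" "0 \<le> c"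
  shows "measure (pos_part_measure \<mu>) A \<le> c"
  using assms unfolding measure_def 
  by (simp add: emeasure_pos_part_measure) (intro enn2real_leI SUP_least ennreal_leI, auto)

lemma measure_pos_part_ge:
  assumes "A \<in> sets borel" "B \<in> sets borel" "B \<subseteq> A"
  shows "\<mu> B \<le> measure (pos_part_measure \<mu>) A"
proof -
  interpret finite_measure "pos_part_measure \<mu>" by (rule finite_measure_pos_part_measure)
  have "ennreal (\<mu> B) \<le> emeasure (pos_part_measure \<mu>) A"
    using assms by (auto simp: emeasure_pos_part_measure intro!: SUP_upper)
  then show ?thesis by (simp add: emeasure_eq_measure)
qed

end

text \<open>Since \<open>\<mu> B = \<mu> A - \<mu> (A - B)\<close>, a bound for
  \<open>- \<mu>\<close> on the subsets of \<open>A\<close> is a bound for \<open>\<mu>\<close>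
  shifted by \<open>\<mu> A\<close>. Taking suprema in both directions gives the equality.\<close>

lemma Jordan_decomposition:
  assumes \<mu>: "finite_signed_borel_measure \<mu>" and A: "A \<in> sets borel"
  shows "\<mu> A = measure (pos_part_measure \<mu>) A - measure (neg_part_measure \<mu>) A"
proof -
  note \<mu>' = finite_signed_borel_measure_uminus[OF \<mu>]
  have "measure (pos_part_measure (\<lambda>A. - \<mu> A)) A \<le> measure (pos_part_measure \<mu>) A - \<mu> A"
  proof (rule measure_pos_part_le[OF \<mu>' A])
    fix B assume B: "B \<in> sets borel" "B \<subseteq> A"
    show "- \<mu> B \<le> measure (pos_part_measure \<mu>) A - \<mu> A"
      using measure_pos_part_ge[OF \<mu> A, of "A - B"] signed_measure_Diff[OF \<mu> A B] A B by auto
  qed (use measure_pos_part_ge[OF \<mu> A A] in auto)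
  moreover have "measure (pos_part_measure \<mu>) A \<le> \<mu> A + measure (pos_part_measure (\<lambda>A. - \<mu> A)) A"
  proof (rule measure_pos_part_le[OF \<mu> A])
    fix B assume B: "B \<in> sets borel" "B \<subseteq> A"
    show "\<mu> B \<le> \<mu> A + measure (pos_part_measure (\<lambda>A. - \<mu> A)) A"
      using measure_pos_part_ge[OF \<mu>' A, of "A - B"] signed_measure_Diff[OF \<mu> A B] A B by auto
  qed (use measure_pos_part_ge[OF \<mu>' A A] in auto)
  ultimately show ?thesis unfolding neg_part_measure_def by linarith
qed

section \<open>Dyadic cubes\<close>

text \<open>The half-open cube of side \<open>1 / 2 ^ j\<close> around \<open>x\<close>. A cube is
  named by any of its points, so that a property of cubes becomes a predicate on points that is
  constant on cubes.\<close>

definition dyadic_cube :: "nat \<Rightarrow> 'a::euclidean_space \<Rightarrow> 'a set" where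
  "dyadic_cube j x = {y. \<forall>b\<in>Basis. \<lfloor>2 ^ j * (y \<bullet> b)\<rfloor> = \<lfloor>2 ^ j * (x \<bullet> b)\<rfloor>}"

lemma mem_dyadic_cube_self [simp]: "x \<in> dyadic_cube j x"
  by (simp add: dyadic_cube_def)

lemma dyadic_cube_eq: "y \<in> dyadic_cube j x \<Longrightarrow> dyadic_cube j y = dyadic_cube j x"
  by (auto simp: dyadic_cube_def)

lemma dyadic_cube_borel [measurable, simp]: "dyadic_cube j x \<in> sets borel"
proof -
  have "Measurable.pred borel (\<lambda>y. \<forall>b\<in>Basis. \<lfloor>2 ^ j * (y \<bullet> b)\<rfloor> = \<lfloor>2 ^ j * (x \<bullet> b)\<rfloor>)"
    by measurable
  then show ?thesis unfolding dyadic_cube_def pred_def by simp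
qed

lemma countable_dyadic_cubes: "countable (range (dyadic_cube j :: 'a::euclidean_space \<Rightarrow> 'a set))"
proof -
  define g where "g x = (\<lambda>b\<in>Basis. \<lfloor>2 ^ j * (x \<bullet> b)\<rfloor>)" for x :: 'a
  have "g x \<in> (\<Pi>\<^sub>E b\<in>Basis. UNIV)" for x by (auto simp: g_def)
  then have "countable (range g)"
    by (intro countable_subset[OF _ countable_PiE[OF finite_Basis]]) (auto simp only: image_subset_iff)
  have eq: "dyadic_cube j x = {y. \<forall>b\<in>Basis. \<lfloor>2 ^ j * (y \<bullet> b)\<rfloor> = g x b}" for x
    by (auto simp: dyadic_cube_def g_def)
  then have "range (dyadic_cube j) = (\<lambda>h. {y. \<forall>b\<in>Basis. \<lfloor>2 ^ j * (y \<bullet> b)\<rfloor> = h b}) ` range g"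
    by auto
  with \<open>countable (range g)\<close> show ?thesis by simp
qed

lemma dyadic_cube_antimono:
  assumes "i \<le> j"
  shows "dyadic_cube j x \<subseteq> dyadic_cube i x"
proof
  \<comment> \<open>The coarse index is the integer quotient of the fine one, also for negative
    coordinates, since \<open>div\<close> rounds down.\<close>
  have *: "\<lfloor>2 ^ i * t\<rfloor> = \<lfloor>2 ^ j * t\<rfloor> div 2 ^ (j - i)" for t :: real
  proof -
    have "2 ^ i * t = (2 ^ j * t) / real_of_int (2 ^ (j - i))"
      using assms by (simp add: field_simps flip: power_add)
    then show ?thesis by (metis floor_divide_real_eq_div zero_le_numeral zero_le_power)
  qed
  fix y assume "y \<in> dyadic_cube j x"
  then show "y \<in> dyadic_cube i x" by (simp add: dyadic_cube_def *)
qed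

lemma dyadic_cube_disjnt: "dyadic_cube j x = dyadic_cube j y \<or> dyadic_cube j x \<inter> dyadic_cube j y = {}"
  by (metis disjoint_iff dyadic_cube_eq)

lemma dyadic_cube_diff:
  assumes "y \<in> dyadic_cube j x" "z \<in> dyadic_cube j x" "b \<in> Basis"
  shows "\<bar>(y - z) \<bullet> b\<bar> < 1 / 2 ^ j"
proof -
  have "\<lfloor>2 ^ j * (y \<bullet> b)\<rfloor> = \<lfloor>2 ^ j * (z \<bullet> b)\<rfloor>" using assms by (simp add: dyadic_cube_def)
  then have "\<bar>2 ^ j * (y \<bullet> b) - 2 ^ j * (z \<bullet> b)\<bar> < 1" by linarith
  then have "2 ^ j * \<bar>(y - z) \<bullet> b\<bar> < 1"
    by (simp add: inner_diff_left abs_mult flip: right_diff_distrib)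
  then show ?thesis by (simp add: field_simps)
qed

lemma dist_dyadic_cube:
  fixes x y z :: "'a::euclidean_space"
  assumes "y \<in> dyadic_cube j x" "z \<in> dyadic_cube j x"
  shows "dist y z \<le> DIM('a) / 2 ^ j"
proof -
  have "norm (y - z) \<le> (\<Sum>b\<in>Basis. \<bar>(y - z) \<bullet> b\<bar>)" by (rule norm_le_l1)
  also have "\<dots> \<le> (\<Sum>b\<in>(Basis::'a set). 1 / 2 ^ j)"
    using dyadic_cube_diff[OF assms] by (intro sum_mono) (auto intro: less_imp_le)
  finally show ?thesis by (simp add: dist_norm)
qed

lemma convex_dyadic_cube: "convex (dyadic_cube j x)"
proof -
  have "dyadic_cube j x = (\<Inter>b\<in>Basis. {y. b \<bullet> y \<ge> \<lfloor>2 ^ j * (x \<bullet> b)\<rfloor> / 2 ^ j} \<inter>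
     {y. b \<bullet> y < (\<lfloor>2 ^ j * (x \<bullet> b)\<rfloor> + 1) / 2 ^ j})"
    unfolding dyadic_cube_def
    by (auto simp: floor_eq_iff field_simps inner_commute)
  then show ?thesis
    by (auto intro!: convex_INT convex_Int convex_halfspace_ge convex_halfspace_lt)
qed

lemma emeasure_dyadic_cube:
  fixes x :: "'a::euclidean_space"
  shows "emeasure lborel (dyadic_cube j x) = ennreal ((1 / 2 ^ j) ^ DIM('a))"
proof -
  define a where "a = (\<Sum>b\<in>Basis. (\<lfloor>2 ^ j * (x \<bullet> b)\<rfloor> / 2 ^ j) *\<^sub>R b)"
  define c where "c = a + (1 / 2 ^ j) *\<^sub>R One"
  have a: "a \<bullet> b = \<lfloor>2 ^ j * (x \<bullet> b)\<rfloor> / 2 ^ j" if "b \<in> Basis" for b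
    using that by (simp add: a_def)
  have c: "c \<bullet> b = (\<lfloor>2 ^ j * (x \<bullet> b)\<rfloor> + 1) / 2 ^ j" if "b \<in> Basis" for b
    using that by (simp add: c_def a inner_add_left add_divide_distrib)
  have ac: "(c - a) \<bullet> b = 1 / 2 ^ j" if "b \<in> Basis" for b
    using that by (simp add: c_def)
  have prod: "(\<Prod>b\<in>Basis. (c - a) \<bullet> b) = (1 / 2 ^ j) ^ DIM('a)"
    using ac by simp
  have le: "a \<bullet> b \<le> c \<bullet> b" if "b \<in> Basis" for b
    using that by (simp add: a c divide_right_mono)
  have s1: "box a c \<subseteq> dyadic_cube j x"
    unfolding dyadic_cube_def
    by (force simp: mem_box a c floor_eq_iff field_simps)
  have s2: "dyadic_cube j x \<subseteq> cbox a c"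
  proof
    fix y assume "y \<in> dyadic_cube j x"
    then have "of_int \<lfloor>2 ^ j * (x \<bullet> b)\<rfloor> \<le> 2 ^ j * (y \<bullet> b)" "2 ^ j * (y \<bullet> b) < of_int \<lfloor>2 ^ j * (x \<bullet> b)\<rfloor> + 1"
      if "b \<in> Basis" for b
      using that unfolding dyadic_cube_def floor_eq_iff by force+
    then show "y \<in> cbox a c"
      by (auto simp: mem_box a c field_simps less_imp_le)
  qed
  show ?thesis
  proof (rule antisym)
    have "emeasure lborel (dyadic_cube j x) \<le> emeasure lborel (cbox a c)"
      using s2 by (intro emeasure_mono) auto
    then show "emeasure lborel (dyadic_cube j x) \<le> ennreal ((1 / 2 ^ j) ^ DIM('a))"
      using le prod by (simp add: emeasure_lborel_cbox_eq)
    have "emeasure lborel (box a c) \<le> emeasure lborel (dyadic_cube j x)"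
      using s1 by (intro emeasure_mono) auto
    then show "ennreal ((1 / 2 ^ j) ^ DIM('a)) \<le> emeasure lborel (dyadic_cube j x)"
      using le prod by (simp add: emeasure_lborel_box_eq)
  qed
qed

lemma dyadic_cube_subset_open:
  fixes x :: "'a::euclidean_space"
  assumes "open E" "x \<in> E"
  shows "\<exists>j0. \<forall>j\<ge>j0. dyadic_cube j x \<subseteq> E"
proof -
  obtain e where e: "e > 0" "ball x e \<subseteq> E" using assms openE by blast
  obtain j0 where j0: "DIM('a) / e < 2 ^ j0" using real_arch_pow[of 2 "DIM('a) / e"] by auto
  have "dyadic_cube j x \<subseteq> ball x e" if "j \<ge> j0" for j
  proof
    fix y assume "y \<in> dyadic_cube j x"
    then have "dist x y \<le> DIM('a) / 2 ^ j" by (intro dist_dyadic_cube) auto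
    also have "\<dots> \<le> DIM('a) / 2 ^ j0" using that by (intro divide_left_mono power_increasing) auto
    also have "\<dots> < e" using j0 e by (simp add: field_simps)
    finally show "y \<in> ball x e" by simp
  qed
  then show ?thesis using e by blast
qed

section \<open>Maximal dyadic cubes with a given property\<close>

text \<open>These are the cubes at which a descent from scale \<open>m\<close> first meets
  \<open>P\<close>. \<open>J\<close> restricts only the scales that are kept; maximality is tested
  against all scales from \<open>m\<close> on, so enlarging \<open>J\<close> merely adds
  cubes.\<close>

definition stopping_cubes :: "(nat \<Rightarrow> 'a::euclidean_space \<Rightarrow> bool) \<Rightarrow> nat \<Rightarrow> nat set \<Rightarrow> 'a set set" where
  "stopping_cubes P m J = {dyadic_cube j x | j x. j \<in> J \<and> m \<le> j \<and> P j x \<and> (\<forall>i\<in>{m..<j}. \<not> P i x)}"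

lemma stopping_cubes_borel: "Q \<in> stopping_cubes P m J \<Longrightarrow> Q \<in> sets borel"
  by (auto simp: stopping_cubes_def)

lemma countable_stopping_cubes: "countable (stopping_cubes P m J)"
proof -
  have "stopping_cubes P m J \<subseteq> (\<Union>j. range (dyadic_cube j))"
    unfolding stopping_cubes_def by blast
  then show ?thesis
    by (rule countable_subset) (intro countable_UN countable_dyadic_cubes, simp)
qed

text \<open>If two members share a point \<open>z\<close>, each is the first cube around
  \<open>z\<close> with the property, so they coincide. The hypothesis makes \<open>P\<close> a
  property of the cube, hence testable at \<open>z\<close>.\<close>

lemma disjoint_stopping_cubes:
  assumes cong: "\<And>j x y. y \<in> dyadic_cube j x \<Longrightarrow> P j y \<longleftrightarrow> P j x"
  shows "disjoint (stopping_cubes P m J)"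
proof (rule disjointI)
  fix Q Q' assume QQ': "Q \<in> stopping_cubes P m J" "Q' \<in> stopping_cubes P m J" "Q \<noteq> Q'"
  have *: "\<exists>j\<ge>m. Q = dyadic_cube j z \<and> P j z \<and> (\<forall>i\<in>{m..<j}. \<not> P i z)"
    if Q: "Q \<in> stopping_cubes P m J" and z: "z \<in> Q" for Q z
  proof -
    obtain j x where x: "m \<le> j" "Q = dyadic_cube j x" "P j x" "\<forall>i\<in>{m..<j}. \<not> P i x"
      using Q unfolding stopping_cubes_def by blast
    have "P i z \<longleftrightarrow> P i x" if "i \<le> j" for i
      using dyadic_cube_antimono[OF that, of x] z x(2) by (intro cong) auto
    moreover have "Q = dyadic_cube j z" using x(2) z dyadic_cube_eq by blast
    ultimately show ?thesis using x by (intro exI[of _ j]) simp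
  qed
  show "Q \<inter> Q' = {}"
  proof (rule ccontr)
    assume "Q \<inter> Q' \<noteq> {}"
    then obtain z where z: "z \<in> Q" "z \<in> Q'" by blast
    obtain i where i: "i \<ge> m" "Q = dyadic_cube i z" "P i z" "\<forall>l\<in>{m..<i}. \<not> P l z"
      using *[OF QQ'(1) z(1)] by blast
    obtain j where j: "j \<ge> m" "Q' = dyadic_cube j z" "P j z" "\<forall>l\<in>{m..<j}. \<not> P l z"
      using *[OF QQ'(2) z(2)] by blast
    have "i = j" using i j by (metis atLeastLessThan_iff linorder_neqE_nat)
    then show False using i(2) j(2) QQ'(3) by simp
  qed
qed

lemma stopping_cubes_cover:
  assumes k: "P k x" "m \<le> k" and J: "{..k} \<subseteq> J"
  shows "x \<in> \<Union>(stopping_cubes P m J)"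
proof -
  define i where "i = (LEAST j. m \<le> j \<and> P j x)"
  have i: "m \<le> i \<and> P i x" unfolding i_def by (rule LeastI[of _ k]) (use k in simp)
  have "i \<le> k" unfolding i_def by (rule Least_le) (use k in simp)
  moreover have "\<not> P l x" if "l \<in> {m..<i}" for l
    using not_less_Least[of l "\<lambda>j. m \<le> j \<and> P j x"] that by (simp add: i_def)
  ultimately have "dyadic_cube i x \<in> stopping_cubes P m J"
    using i J unfolding stopping_cubes_def by blast
  then show ?thesis using mem_dyadic_cube_self by blast
qed

text \<open>Countable additivity on both sides. In the applications \<open>N\<close> is a density
  measure, which turns estimates on single cubes into one by a single integral.\<close>

lemma emeasure_Union_le:
  assumes sets: "sets M = sets N" and \<C>: "countable \<C>" "\<C> \<subseteq> sets M" "disjoint \<C>"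
    and le: "\<And>Q. Q \<in> \<C> \<Longrightarrow> emeasure M Q \<le> emeasure N Q"
  shows "emeasure M (\<Union>\<C>) \<le> emeasure N (\<Union>\<C>)"
proof -
  have d: "disjoint_family_on (\<lambda>Q. Q) \<C>"
    using \<C>(3) by (auto simp: disjoint_family_on_def disjoint_def)
  have "emeasure M (\<Union>Q\<in>\<C>. Q) = (\<integral>\<^sup>+Q. emeasure M Q \<partial>count_space \<C>)"
    using \<C> d by (intro emeasure_UN_countable) auto
  also have "\<dots> \<le> (\<integral>\<^sup>+Q. emeasure N Q \<partial>count_space \<C>)"
    by (intro nn_integral_mono) (auto intro: le)
  also have "\<dots> = emeasure N (\<Union>Q\<in>\<C>. Q)"
    using \<C> d sets by (intro emeasure_UN_countable[symmetric]) auto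
  finally show ?thesis by simp
qed

section \<open>Averaged difference quotients and the relative isoperimetric inequality\<close>

text \<open>Integrated over \<open>z\<close>, this sums the volumes of the symmetric differences of
  \<open>E\<close> with its translates by vectors of size about \<open>r\<close>. For a nice set in
  dimension N the result is of order r to the power N + 1 times the perimeter.\<close>

definition jump :: "'a::euclidean_space set \<Rightarrow> real \<Rightarrow> 'a \<Rightarrow> ennreal" where
  "jump E r z = emeasure lborel {k \<in> box (- (r *\<^sub>R One)) (r *\<^sub>R One). (z \<in> E) \<noteq> (z + k \<in> E)}"

lemma jump_sets [measurable]:
  assumes [measurable]: "E \<in> sets borel"
  shows "{(z, k). k \<in> box a b \<and> (z \<in> E) \<noteq> (z + k \<in> E)} \<in> sets (borel \<Otimes>\<^sub>M borel)"
proof -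
  have "Measurable.pred (borel \<Otimes>\<^sub>M borel) (\<lambda>x. snd x \<in> box a b \<and> (fst x \<in> E) \<noteq> (fst x + snd x \<in> E))"
    by measurable
  then show ?thesis by (simp add: pred_def space_pair_measure case_prod_unfold)
qed

lemma borel_measurable_jump [measurable]:
  assumes "E \<in> sets borel"
  shows "jump E r \<in> borel_measurable borel"
proof -
  have "{(z, k). k \<in> box (- (r *\<^sub>R One)) (r *\<^sub>R One) \<and> (z \<in> E) \<noteq> (z + k \<in> E)} \<in> sets (borel \<Otimes>\<^sub>M lborel)"
    using jump_sets[OF assms] by simp
  from lborel.measurable_emeasure_Pair[OF this] show ?thesis
    unfolding jump_def[abs_def] by (simp add: vimage_def)
qed

lemma nn_integral_lborel_translate:
  assumes "f \<in> borel_measurable borel"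
  shows "(\<integral>\<^sup>+x. f (x + a) \<partial>lborel) = (\<integral>\<^sup>+x. f x \<partial>(lborel :: 'a::euclidean_space measure))"
proof -
  have "(\<integral>\<^sup>+x. f x \<partial>lborel) = (\<integral>\<^sup>+x. f x \<partial>distr lborel borel ((+) a))"
    by (simp add: lborel_distr_plus)
  also have "\<dots> = (\<integral>\<^sup>+x. f (x + a) \<partial>lborel)"
    using assms by (simp add: nn_integral_distr add.commute)
  finally show ?thesis ..
qed

lemma nn_integral_lborel_affine:
  fixes a :: "'a::euclidean_space"
  assumes [measurable]: "f \<in> borel_measurable borel" and "m > 0"
  shows "(\<integral>\<^sup>+x. f x \<partial>lborel) = ennreal (m ^ DIM('a)) * (\<integral>\<^sup>+k. f (a + m *\<^sub>R k) \<partial>lborel)"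
proof -
  have "(\<integral>\<^sup>+x. f x \<partial>lborel) =
      (\<integral>\<^sup>+x. f x \<partial>density (distr lborel borel (\<lambda>x. a + m *\<^sub>R x)) (\<lambda>_. ennreal (\<bar>m\<bar> ^ DIM('a))))"
    using assms lborel_affine[of m a] by simp
  also have "\<dots> = ennreal (m ^ DIM('a)) * (\<integral>\<^sup>+k. f (a + m *\<^sub>R k) \<partial>lborel)"
    using assms(2) by (simp add: nn_integral_density nn_integral_distr nn_integral_cmult)
  finally show ?thesis .
qed

lemma dyadic_cube_segment_mem:
  assumes x: "x \<in> P" "x + m *\<^sub>R k \<in> P" and P: "P = dyadic_cube j x0" and m: "m > 0" and i: "0 \<le> i" "i \<le> m"
  shows "x + i *\<^sub>R k \<in> P"
proof -
  have "(1 - i / m) *\<^sub>R x + (i / m) *\<^sub>R (x + m *\<^sub>R k) \<in> P"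
    unfolding P using x i m convex_dyadic_cube by (intro convexD) (auto simp: P)
  moreover have "(1 - i / m) *\<^sub>R x + (i / m) *\<^sub>R (x + m *\<^sub>R k) = x + i *\<^sub>R k"
    using m by (simp add: algebra_simps)
  ultimately show ?thesis by simp
qed

text \<open>The segment from a point of \<open>P \<inter> E\<close> to a point of \<open>P - E\<close>, cut into
  \<open>2 ^ (p - j)\<close> equal steps, has a step with exactly one endpoint in \<open>E\<close>.\<close>

lemma dyadic_cube_isoperimetric:
  fixes E :: "'a::euclidean_space set"
  assumes E [measurable]: "E \<in> sets borel" and "j \<le> p" and P: "P = dyadic_cube j x0"
  shows "emeasure lborel (P \<inter> E) * emeasure lborel (P - E) \<le>
    ennreal ((2 ^ (p - j)) ^ (DIM('a) + 1)) * (\<integral>\<^sup>+z\<in>P. jump E (1 / 2 ^ p) z \<partial>lborel)"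
proof -
  define M :: nat where "M = 2 ^ (p - j)"
  define m where "m = real M"
  define U :: "'a set" where "U = box (- ((1 / 2 ^ p) *\<^sub>R One)) ((1 / 2 ^ p) *\<^sub>R One)"
  define S where "S = {(z, k). z \<in> P \<and> k \<in> U \<and> (z \<in> E) \<noteq> (z + k \<in> E)}"
  have m: "m > 0" "m = 2 ^ (p - j)" by (auto simp: m_def M_def)
  have P_m [measurable]: "P \<in> sets borel" using P by simp
  have [measurable]: "S \<in> sets (borel \<Otimes>\<^sub>M borel)"
  proof -
    have "Measurable.pred (borel \<Otimes>\<^sub>M borel) (\<lambda>x. fst x \<in> P \<and> snd x \<in> U \<and> (fst x \<in> E) \<noteq> (fst x + snd x \<in> E))"
      unfolding U_def by measurable
    then show ?thesis by (simp add: S_def pred_def space_pair_measure case_prod_unfold)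
  qed
  \<comment> \<open>The step \<open>k\<close> is the \<open>m\<close>-th part of a segment inside
    \<open>P\<close>, so its coordinates are below \<open>1 / 2 ^ p\<close>.\<close>
  have U: "k \<in> U" if "x \<in> P" "x + m *\<^sub>R k \<in> P" for x k
  proof -
    have "\<bar>k \<bullet> b\<bar> < 1 / 2 ^ p" if "b \<in> Basis" for b
    proof -
      have "\<bar>((x + m *\<^sub>R k) - x) \<bullet> b\<bar> < 1 / 2 ^ j"
        using \<open>x \<in> P\<close> \<open>x + m *\<^sub>R k \<in> P\<close> that unfolding P by (intro dyadic_cube_diff)
      then have "m * \<bar>k \<bullet> b\<bar> < 1 / 2 ^ j" using m(1) by (simp add: abs_mult)
      moreover have "1 / 2 ^ j = m * (1 / 2 ^ p)"
        using \<open>j \<le> p\<close> m(2) by (simp add: field_simps flip: power_add)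
      ultimately show ?thesis using m(1) by (metis mult_less_cancel_left_pos)
    qed
    then show ?thesis by (force simp: U_def mem_box abs_less_iff)
  qed
  have pw: "indicator (P \<inter> E) x * indicator (P - E) (x + m *\<^sub>R k) \<le>
      (\<Sum>i<M. indicator S (x + real i *\<^sub>R k, k) :: ennreal)" for x k
  proof (cases "x \<in> P \<inter> E \<and> x + m *\<^sub>R k \<in> P - E")
    case True
    have "\<exists>i<M. (x + real i *\<^sub>R k \<in> E) \<noteq> (x + real (Suc i) *\<^sub>R k \<in> E)"
    proof (rule ccontr)
      assume *: "\<not> ?thesis"
      have "i \<le> M \<Longrightarrow> x + real i *\<^sub>R k \<in> E" for i
        by (induction i) (use * True in auto)
      from this[of M] True show False by (simp add: m_def)
    qed
    then obtain i where i: "i < M" "(x + real i *\<^sub>R k \<in> E) \<noteq> (x + real (Suc i) *\<^sub>R k \<in> E)" by blast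
    have "x + real i *\<^sub>R k \<in> P"
      by (rule dyadic_cube_segment_mem[where m = m, OF _ _ P]) (use True i(1) m(1) in \<open>auto simp: m_def\<close>)
    then have "(x + real i *\<^sub>R k, k) \<in> S"
      using i(2) U[of x k] True by (auto simp: S_def algebra_simps)
    then have "1 \<le> (indicator S (x + real i *\<^sub>R k, k) :: ennreal)" by simp
    also have "\<dots> \<le> (\<Sum>i<M. indicator S (x + real i *\<^sub>R k, k))"
      using i(1) by (intro member_le_sum) auto
    finally show ?thesis using True by simp
  qed (auto simp: indicator_def)
  have "emeasure lborel (P \<inter> E) * emeasure lborel (P - E) =
      (\<integral>\<^sup>+x. indicator (P \<inter> E) x * emeasure lborel (P - E) \<partial>lborel)"
    by (simp add: nn_integral_multc)
  \<comment> \<open>For fixed \<open>x\<close> the second endpoint is written as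
    \<open>x + m *\<^sub>R k\<close>; the scaling contributes \<open>m ^ DIM('a)\<close>.\<close>
  also have "\<dots> = (\<integral>\<^sup>+x. indicator (P \<inter> E) x *
      (ennreal (m ^ DIM('a)) * (\<integral>\<^sup>+k. indicator (P - E) (x + m *\<^sub>R k) \<partial>lborel)) \<partial>lborel)"
    by (intro nn_integral_cong, subst nn_integral_lborel_affine[symmetric]) (use m in auto)
  also have "\<dots> = ennreal (m ^ DIM('a)) * (\<integral>\<^sup>+x. \<integral>\<^sup>+k. indicator (P \<inter> E) x * indicator (P - E) (x + m *\<^sub>R k) \<partial>lborel \<partial>lborel)"
    by (simp add: nn_integral_cmult[symmetric] ac_simps)
  also have "\<dots> \<le> ennreal (m ^ DIM('a)) * (\<integral>\<^sup>+x. \<integral>\<^sup>+k. (\<Sum>i<M. indicator S (x + real i *\<^sub>R k, k)) \<partial>lborel \<partial>lborel)"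
    by (intro mult_left_mono nn_integral_mono pw) simp
  also have "(\<integral>\<^sup>+x. \<integral>\<^sup>+k. (\<Sum>i<M. indicator S (x + real i *\<^sub>R k, k) :: ennreal) \<partial>lborel \<partial>lborel) =
      (\<Sum>i<M. \<integral>\<^sup>+x. \<integral>\<^sup>+k. indicator S (x + real i *\<^sub>R k, k) \<partial>lborel \<partial>lborel)"
    by (simp add: nn_integral_sum)
  also have "\<dots> = (\<Sum>i<M. \<integral>\<^sup>+k. \<integral>\<^sup>+x. indicator S (x + real i *\<^sub>R k, k) \<partial>lborel \<partial>lborel)"
    by (intro sum.cong refl lborel_pair.Fubini') measurable
  \<comment> \<open>For fixed \<open>k\<close> the shift by \<open>real i *\<^sub>R k\<close>
    preserves Lebesgue measure, so all \<open>M\<close> summands agree. This is the additional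
    factor \<open>m\<close>.\<close>
  also have "\<dots> = (\<Sum>i<M. \<integral>\<^sup>+k. \<integral>\<^sup>+x. indicator S (x, k) \<partial>lborel \<partial>lborel)"
    by (intro sum.cong refl nn_integral_cong nn_integral_lborel_translate) measurable
  also have "\<dots> = ennreal m * (\<integral>\<^sup>+k. \<integral>\<^sup>+x. indicator S (x, k) \<partial>lborel \<partial>lborel)"
    by (simp add: m_def ennreal_of_nat_eq_real_of_nat)
  also have "(\<integral>\<^sup>+k. \<integral>\<^sup>+x. indicator S (x, k) \<partial>lborel \<partial>lborel) = (\<integral>\<^sup>+x. \<integral>\<^sup>+k. (indicator S (x, k) :: ennreal) \<partial>lborel \<partial>lborel)"
    by (intro lborel_pair.Fubini') measurable
  also have "\<dots> = (\<integral>\<^sup>+z\<in>P. jump E (1 / 2 ^ p) z \<partial>lborel)"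
  proof (rule nn_integral_cong)
    fix z
    have "(\<integral>\<^sup>+k. indicator S (z, k) \<partial>lborel) = (\<integral>\<^sup>+k. indicator {k \<in> U. (z \<in> E) \<noteq> (z + k \<in> E)} k * indicator P z \<partial>lborel)"
      by (intro nn_integral_cong) (auto simp: S_def indicator_def)
    also have "\<dots> = (\<integral>\<^sup>+k. indicator {k \<in> U. (z \<in> E) \<noteq> (z + k \<in> E)} k \<partial>lborel) * indicator P z"
      unfolding U_def by (rule nn_integral_multc) measurable
    also have "\<dots> = jump E (1 / 2 ^ p) z * indicator P z"
      unfolding U_def jump_def by (subst nn_integral_indicator) (auto simp: U_def)
    finally show "(\<integral>\<^sup>+k. indicator S (z, k) \<partial>lborel) = jump E (1 / 2 ^ p) z * indicator P z" .
  qed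
  finally show ?thesis
    using m(1) by (simp add: m(2) ennreal_mult ac_simps)
qed

section \<open>Trace inequality for measures of bounded growth\<close>

lemma dyadic_length_power:
  "(1 / 2 ^ j) ^ (DIM('a::euclidean_space) - 1) = 2 ^ j * (1 / 2 ^ j :: real) ^ DIM('a)"
proof -
  obtain m where "DIM('a) = Suc m" using DIM_positive[where 'a='a] gr0_conv_Suc by blast
  then show ?thesis by simp
qed

text \<open>Small cubes around a point of \<open>E\<close> lie in \<open>E\<close>. If the one of
  scale \<open>j0\<close> is at most half full, some cube further down is at most half full and has
  a child more than half full. Such a cube contains a fixed share of both \<open>E\<close> and its
  complement, so the isoperimetric inequality bounds its side to the power N - 1, hence its mass.
  Cubes of scale \<open>j0\<close> that are more than half full account for the volume term.\<close>

lemma emeasure_open_le_liminf_jump: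
  fixes E :: "'a::euclidean_space set"
  assumes sets [simp, measurable_cong]: "sets \<nu> = sets borel" and E: "open E" and a: "a \<ge> 0"
    and growth: "\<And>j x. j \<ge> j0 \<Longrightarrow> emeasure \<nu> (dyadic_cube j x) \<le> ennreal (a * (1 / 2 ^ j) ^ (DIM('a) - 1))"
  shows "emeasure \<nu> E \<le>
    liminf (\<lambda>p. ennreal (a * 2 ^ (DIM('a) + 2) * (2 ^ p) ^ (DIM('a) + 1)) * (\<integral>\<^sup>+z. jump E (1 / 2 ^ p) z \<partial>lborel))
    + ennreal (2 * a * 2 ^ j0) * emeasure lborel E"
proof -
  let ?N = "DIM('a)"
  have [measurable]: "E \<in> sets borel" using E by simp
  define v where "v j x = measure lborel (dyadic_cube j x \<inter> E)" for j x
  have fin: "emeasure lborel (dyadic_cube j x \<inter> E) \<noteq> \<infinity>" for j and x :: 'a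
  proof -
    have "emeasure lborel (dyadic_cube j x \<inter> E) \<le> emeasure lborel (dyadic_cube j x)"
      by (intro emeasure_mono) auto
    then show ?thesis by (auto simp: emeasure_dyadic_cube top_unique)
  qed
  have v: "emeasure lborel (dyadic_cube j x \<inter> E) = ennreal (v j x)" for j x
    unfolding v_def using fin by (simp add: emeasure_eq_ennreal_measure)
  have v_le: "v j x \<le> v i x" if "i \<le> j" for i j x
    unfolding v_def
    by (intro measure_mono_fmeasurable) (use dyadic_cube_antimono[OF that] fin in \<open>auto simp: fmeasurable_def top.not_eq_extremum\<close>)
  define dens where "dens j x \<longleftrightarrow> (1 / 2 ^ j) ^ ?N < 2 * v j x" for j x
  define P where "P j x \<longleftrightarrow> \<not> dens j x \<and> (\<exists>y\<in>dyadic_cube j x. dens (Suc j) y)" for j x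
  \<comment> \<open>Scales stop at \<open>p\<close> because the isoperimetric inequality with step
    \<open>1 / 2 ^ p\<close> requires \<open>j \<le> p\<close>.\<close>
  define \<C> where "\<C> p = stopping_cubes P j0 {..p}" for p
  define Big where "Big = {dyadic_cube j0 x | x. dens j0 x}"
  have v_cong: "v j y = v j x" if "y \<in> dyadic_cube j x" for j x y
    using dyadic_cube_eq[OF that] by (simp add: v_def)
  have P_cong: "P j y \<longleftrightarrow> P j x" if "y \<in> dyadic_cube j x" for j x y
    using dyadic_cube_eq[OF that] v_cong[OF that] by (simp add: P_def dens_def)
  have disj\<C>: "disjoint (\<C> p)" for p
    unfolding \<C>_def by (rule disjoint_stopping_cubes[OF P_cong])
  have disjBig: "disjoint Big"
    unfolding Big_def by (rule disjointI) (use dyadic_cube_disjnt in blast)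
  have count\<C>: "countable (\<C> p)" for p
    unfolding \<C>_def by (rule countable_stopping_cubes)
  have countBig: "countable Big"
    unfolding Big_def by (rule countable_subset[OF _ countable_dyadic_cubes]) auto
  have sets\<C>: "\<C> p \<subseteq> sets borel" for p using stopping_cubes_borel by (auto simp: \<C>_def)
  have setsBig: "Big \<subseteq> sets borel" by (auto simp: Big_def)

  define c where "c p = a * 2 ^ (?N + 2) * (2 ^ p) ^ (?N + 1)" for p :: nat
  have c: "c p \<ge> 0" for p using a by (simp add: c_def)
  have Q_le: "emeasure \<nu> Q \<le> ennreal (c p) * (\<integral>\<^sup>+z\<in>Q. jump E (1 / 2 ^ p) z \<partial>lborel)"
    if Q: "Q = dyadic_cube j x" "P j x" and j: "j0 \<le> j" "j \<le> p" for Q j x p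
  proof -
    note x = Q
    obtain y where y: "y \<in> Q" "dens (Suc j) y" using x unfolding P_def by blast
    define q :: real where "q = (1 / 2 ^ j) ^ ?N"
    have q: "q > 0" by (simp add: q_def)
    have up: "2 * v j x \<le> q" using x(2) by (simp add: P_def dens_def q_def)
    \<comment> \<open>The child has volume \<open>q / 2 ^ ?N\<close>, and more than half of it lies
      in \<open>E\<close>.\<close>
    have "q / 2 ^ ?N = (1 / 2 ^ Suc j) ^ ?N" by (simp add: q_def power_divide power_mult_distrib)
    also have "\<dots> < 2 * v (Suc j) y" using y(2) by (simp add: dens_def)
    also have "\<dots> \<le> 2 * v j y" using v_le[of j "Suc j" y] by simp
    also have "v j y = v j x" using y(1) x(1) by (intro v_cong) auto
    finally have low: "q / 2 ^ (?N + 1) \<le> v j x" by (simp add: field_simps)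
    have "emeasure lborel (Q - E) = emeasure lborel (Q - Q \<inter> E)"
      by (rule arg_cong[where f = "emeasure lborel"]) blast
    also have "\<dots> = ennreal q - ennreal (v j x)"
      using fin[of j x] x(1) v by (subst emeasure_Diff) (auto simp: emeasure_dyadic_cube q_def)
    finally have QE: "emeasure lborel (Q - E) = ennreal (q - v j x)"
      by (simp add: ennreal_minus v_def)
    define J where "J = (\<integral>\<^sup>+z\<in>Q. jump E (1 / 2 ^ p) z \<partial>lborel)"
    have "ennreal (q / 2 ^ (?N + 1)) * ennreal (q / 2) \<le> ennreal (v j x) * ennreal (q - v j x)"
      using low up by (intro mult_mono ennreal_leI) auto
    also have "\<dots> \<le> ennreal ((2 ^ (p - j)) ^ (?N + 1)) * J"
      using dyadic_cube_isoperimetric[OF _ j(2) x(1), of E] QE v[of j x] x(1) by (simp add: J_def)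
    finally have iso: "ennreal (q / 2 ^ (?N + 1) * (q / 2)) \<le> ennreal ((2 ^ (p - j)) ^ (?N + 1)) * J"
      using q by (subst ennreal_mult) auto
    \<comment> \<open>\<open>2 ^ (?N + 2)\<close> undoes the shares \<open>1 / 2 ^ (?N + 1)\<close>
      and \<open>1 / 2\<close>; \<open>(2 ^ j) ^ (?N + 1)\<close> turns the squared volume
      \<open>q * q\<close> into the side to the power N - 1.\<close>
    define d where "d = a * 2 ^ (?N + 2) * (2 ^ j) ^ (?N + 1)"
    have d: "d \<ge> 0" using a by (simp add: d_def)
    have "(1 / 2 ^ j) ^ (?N - 1) = q * (2 ^ j) ^ 1"
      by (simp only: dyadic_length_power q_def) simp
    also have "\<dots> = q * q * (2 ^ j) ^ (?N + 1)"
      by (simp add: q_def power_divide)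
    finally have "a * (1 / 2 ^ j) ^ (?N - 1) = d * (q / 2 ^ (?N + 1) * (q / 2))"
      by (simp add: d_def field_simps)
    then have "emeasure \<nu> Q \<le> ennreal d * ennreal (q / 2 ^ (?N + 1) * (q / 2))"
      using growth[OF j(1), of x] x(1) d by (simp only: ennreal_mult')
    also have "\<dots> \<le> ennreal d * (ennreal ((2 ^ (p - j)) ^ (?N + 1)) * J)"
      by (intro mult_left_mono iso) simp
    also have "\<dots> = ennreal (d * (2 ^ (p - j)) ^ (?N + 1)) * J"
      using d by (simp add: ennreal_mult mult.assoc)
    \<comment> \<open>The scale \<open>j\<close> cancels: all cubes get the same constant and can be
      summed.\<close>
    also have "d * (2 ^ (p - j)) ^ (?N + 1) = c p"
    proof -
      have "(2 ^ j) ^ (?N + 1) * (2 ^ (p - j)) ^ (?N + 1) = ((2 ^ p) ^ (?N + 1) :: real)"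
        using j(2) by (simp only: power_mult_distrib[symmetric] power_add[symmetric]) simp
      then show ?thesis by (simp add: c_def d_def mult.assoc)
    qed
    finally show ?thesis by (simp add: J_def)
  qed
  \<comment> \<open>The family with bound \<open>p\<close> is estimated using every finer step
    \<open>p'\<close>, so that the limit inferior over \<open>p'\<close> can be taken before the
    supremum over \<open>p\<close>.\<close>
  have le\<C>: "emeasure \<nu> (\<Union>(\<C> p)) \<le> ennreal (c p') * (\<integral>\<^sup>+z. jump E (1 / 2 ^ p') z \<partial>lborel)" if "p \<le> p'" for p p'
  proof -
    define M where "M = density lborel (\<lambda>z. ennreal (c p') * jump E (1 / 2 ^ p') z)"
    have M: "emeasure M A = ennreal (c p') * (\<integral>\<^sup>+z\<in>A. jump E (1 / 2 ^ p') z \<partial>lborel)" if "A \<in> sets borel" for A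
      using that unfolding M_def
      by (subst emeasure_density) (auto simp: mult.assoc nn_integral_cmult)
    have "emeasure \<nu> (\<Union>(\<C> p)) \<le> emeasure M (\<Union>(\<C> p))"
    proof (rule emeasure_Union_le)
      fix Q assume "Q \<in> \<C> p"
      then obtain j x where "Q = dyadic_cube j x" "P j x" "j0 \<le> j" "j \<le> p"
        unfolding \<C>_def stopping_cubes_def by blast
      then show "emeasure \<nu> Q \<le> emeasure M Q"
        using Q_le[of Q j x p'] \<open>p \<le> p'\<close> by (subst M) auto
    qed (use count\<C> disj\<C> sets\<C> in \<open>auto simp: M_def\<close>)
    also have "\<dots> \<le> emeasure M UNIV" by (intro emeasure_mono) (auto simp: M_def)
    finally show ?thesis by (simp add: M)
  qed
  have leBig: "emeasure \<nu> (\<Union>Big) \<le> ennreal (2 * a * 2 ^ j0) * emeasure lborel E"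
  proof -
    define M where "M = density lborel (\<lambda>z. ennreal (2 * a * 2 ^ j0) * indicator E z)"
    have M: "emeasure M A = ennreal (2 * a * 2 ^ j0) * emeasure lborel (A \<inter> E)" if "A \<in> sets borel" for A
    proof -
      have "emeasure M A = (\<integral>\<^sup>+z. ennreal (2 * a * 2 ^ j0) * indicator (A \<inter> E) z \<partial>lborel)"
        using that unfolding M_def
        by (subst emeasure_density) (auto intro!: nn_integral_cong simp: indicator_def)
      then show ?thesis using that by (simp add: nn_integral_cmult_indicator)
    qed
    have "emeasure \<nu> (\<Union>Big) \<le> emeasure M (\<Union>Big)"
    proof (rule emeasure_Union_le)
      fix Q assume "Q \<in> Big"
      then obtain x where x: "Q = dyadic_cube j0 x" "dens j0 x" unfolding Big_def by blast
      \<comment> \<open>At the fixed scale \<open>j0\<close> the side to the power N - 1 is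
        \<open>2 ^ j0\<close> times the volume, which is less than twice the volume of the part in
        \<open>E\<close>.\<close>
      have "(1 / 2 ^ j0) ^ (?N - 1) = 2 ^ j0 * (1 / 2 ^ j0 :: real) ^ ?N"
        by (rule dyadic_length_power)
      also have "\<dots> \<le> 2 ^ j0 * (2 * v j0 x)"
        using x(2) by (simp add: dens_def)
      finally have "a * (1 / 2 ^ j0) ^ (?N - 1) \<le> 2 * a * 2 ^ j0 * v j0 x"
        using a by (metis (no_types, opaque_lifting) mult.assoc mult.left_commute mult_left_mono)
      then have "emeasure \<nu> Q \<le> ennreal (2 * a * 2 ^ j0 * v j0 x)"
        using growth[of j0 x] x(1) by (auto intro: order_trans ennreal_leI)
      also have "\<dots> = emeasure M Q"
        using a x(1) v[of j0 x] by (subst M) (auto simp: ennreal_mult v_def)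
      finally show "emeasure \<nu> Q \<le> emeasure M Q" .
    qed (use countBig disjBig setsBig in \<open>auto simp: M_def\<close>)
    also have "\<dots> \<le> emeasure M UNIV" by (intro emeasure_mono) (auto simp: M_def)
    finally show ?thesis by (simp add: M)
  qed
  have U\<C> [measurable]: "\<Union>(\<C> p) \<in> sets borel" for p
    using count\<C> sets\<C> by (intro sets.countable_Union) auto
  have UBig [measurable]: "\<Union>Big \<in> sets borel"
    using countBig setsBig by (intro sets.countable_Union) auto
  have cover: "E \<subseteq> (\<Union>p. \<Union>(\<C> p)) \<union> \<Union>Big"
  proof
    fix x assume x: "x \<in> E"
    show "x \<in> (\<Union>p. \<Union>(\<C> p)) \<union> \<Union>Big"
    proof (cases "dens j0 x")
      case True
      then show ?thesis using mem_dyadic_cube_self[of x j0] unfolding Big_def by blast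
    next
      case False
      obtain J where J: "\<forall>j\<ge>J. dyadic_cube j x \<subseteq> E" using dyadic_cube_subset_open[OF E x] by blast
      have "dens j x" if "j \<ge> J" for j
      proof -
        have "dyadic_cube j x \<inter> E = dyadic_cube j x" using J that by blast
        then have "v j x = (1 / 2 ^ j) ^ ?N" by (simp add: v_def measure_def emeasure_dyadic_cube)
        then show ?thesis by (simp add: dens_def)
      qed
      then have ex: "\<exists>j. j \<ge> j0 \<and> dens j x" by (meson nat_le_linear)
      \<comment> \<open>The first scale from \<open>j0\<close> on at which the cube around
        \<open>x\<close> is more than half full; the parent of that cube satisfies
        \<open>P\<close>.\<close>
      define k where "k = (LEAST j. j \<ge> j0 \<and> dens j x)"
      have k: "k \<ge> j0" "dens k x" using LeastI_ex[OF ex] by (auto simp: k_def)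
      have "k \<noteq> j0" using k False by auto
      then obtain j where j: "k = Suc j" "j \<ge> j0" using k(1) by (cases k) auto
      have "\<not> dens j x" using j not_less_Least[of j "\<lambda>j. j \<ge> j0 \<and> dens j x"] by (auto simp: k_def)
      then have "P j x" using k(2) j mem_dyadic_cube_self unfolding P_def by blast
      then have "x \<in> \<Union>(\<C> j)" unfolding \<C>_def using j by (intro stopping_cubes_cover[of P j]) auto
      then show ?thesis by blast
    qed
  qed
  have "emeasure \<nu> E \<le> emeasure \<nu> ((\<Union>p. \<Union>(\<C> p)) \<union> \<Union>Big)"
    using cover by (intro emeasure_mono) auto
  also have "\<dots> \<le> emeasure \<nu> (\<Union>p. \<Union>(\<C> p)) + emeasure \<nu> (\<Union>Big)"
    by (intro emeasure_subadditive) auto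
  also have "emeasure \<nu> (\<Union>p. \<Union>(\<C> p)) = (SUP p. emeasure \<nu> (\<Union>(\<C> p)))"
  proof (rule SUP_emeasure_incseq[symmetric])
    show "range (\<lambda>p. \<Union>(\<C> p)) \<subseteq> sets \<nu>" using U\<C> by auto
    have "\<C> p \<subseteq> \<C> p'" if "p \<le> p'" for p p'
      unfolding \<C>_def stopping_cubes_def using that by clarsimp (metis order_trans)
    then show "incseq (\<lambda>p. \<Union>(\<C> p))" unfolding incseq_def by (meson Union_mono)
  qed
  also have "\<dots> \<le> liminf (\<lambda>p. ennreal (c p) * (\<integral>\<^sup>+z. jump E (1 / 2 ^ p) z \<partial>lborel))"
    by (intro SUP_least Liminf_bounded) (auto simp: eventually_sequentially intro!: exI le\<C>)
  finally show ?thesis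
    using leBig by (simp add: c_def add_mono order_trans)
qed

section \<open>Calculus of C^k functions, translation estimate and coarea formula\<close>

lemma C_k_SucI:
  assumes "\<And>x. (f has_derivative D x) (at x)" "\<And>v. C_k k (\<lambda>x. D x v)"
  shows "C_k (Suc k) f"
proof -
  have "frechet_derivative f (at x) = D x" for x
    using frechet_derivative_at[OF assms(1)] by simp
  then show ?thesis using assms by (auto simp: differentiable_def)
qed

lemma C_k_SucD: "C_k (Suc k) f \<Longrightarrow> (f has_derivative frechet_derivative f (at x)) (at x)"
  by (simp add: frechet_derivative_works)

lemma C_k_Suc_imp_C_k: "C_k (Suc k) f \<Longrightarrow> C_k k f"
proof (induction k arbitrary: f)
  case 0
  then show ?case
    by (auto intro!: continuous_at_imp_continuous_on differentiable_imp_continuous_within)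
next
  case (Suc k)
  then show ?case by (metis C_k.simps(2))
qed

lemma C_k_continuous: "C_k k f \<Longrightarrow> continuous_on UNIV f"
proof (induction k)
  case (Suc k)
  then show ?case using C_k_Suc_imp_C_k by blast
qed simp

text \<open>The functional is the inner product with its gradient, and Cauchy-Schwarz is attained at
  the gradient. The explicit formula shows that the operator norm of a derivative depends
  continuously on the base point.\<close>

lemma onorm_real_linear:
  fixes f :: "'a::euclidean_space \<Rightarrow> real"
  assumes "linear f"
  shows "onorm f = norm (\<Sum>b\<in>Basis. f b *\<^sub>R b)"
proof -
  define g where "g = (\<Sum>b\<in>Basis. f b *\<^sub>R b)"
  have f: "f x = g \<bullet> x" for x
  proof -
    have "f x = f (\<Sum>b\<in>Basis. (x \<bullet> b) *\<^sub>R b)" by (simp add: euclidean_representation)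
    also have "\<dots> = (\<Sum>b\<in>Basis. (x \<bullet> b) * f b)"
      using assms by (simp add: linear_sum linear_scale)
    also have "\<dots> = g \<bullet> x" unfolding g_def inner_sum_left
      by (intro sum.cong refl) (simp add: inner_commute mult.commute)
    finally show ?thesis .
  qed
  have "onorm (\<lambda>x. g \<bullet> x) = norm g"
  proof (rule antisym)
    show "onorm (\<lambda>x. g \<bullet> x) \<le> norm g"
      by (rule onorm_bound) (use Cauchy_Schwarz_ineq2 in auto)
    have "norm (g \<bullet> g) \<le> onorm (\<lambda>x. g \<bullet> x) * norm g"
      by (rule onorm) (rule bounded_linear_inner_right)
    moreover have "norm (g \<bullet> g) = norm g * norm g"
      by (metis abs_norm_cancel abs_mult dot_square_norm power2_eq_square real_norm_def)
    ultimately have "norm g * norm g \<le> onorm (\<lambda>x. g \<bullet> x) * norm g" by simp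
    moreover have "0 \<le> onorm (\<lambda>x. g \<bullet> x)"
      by (rule onorm_pos_le) (rule bounded_linear_inner_right)
    ultimately show "norm g \<le> onorm (\<lambda>x. g \<bullet> x)"
      by (cases "g = 0") (simp_all add: mult_le_cancel_right)
  qed
  moreover have "f = (\<lambda>x. g \<bullet> x)" using f by auto
  ultimately have "onorm f = norm g" by simp
  then show ?thesis by (simp only: g_def)
qed

lemma continuous_on_onorm_frechet_derivative:
  assumes "C_k (Suc k) f"
  shows "continuous_on UNIV (\<lambda>x. onorm (frechet_derivative f (at x)))"
proof -
  have "linear (frechet_derivative f (at x))" for x
    using C_k_SucD[OF assms] has_derivative_linear by blast
  then have "onorm (frechet_derivative f (at x)) = norm (\<Sum>b\<in>Basis. frechet_derivative f (at x) b *\<^sub>R b)" for x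
    by (rule onorm_real_linear)
  moreover have "continuous_on UNIV (\<lambda>x. frechet_derivative f (at x) b)" for b
    using assms C_k_continuous by auto
  ultimately show ?thesis by (simp only:) (intro continuous_intros)
qed

text \<open>The fundamental theorem of calculus along the segment from \<open>z\<close> to
  \<open>z + k\<close> bounds the increment by an average of gradient norms; Fubini and translation
  invariance remove the average.\<close>

lemma nn_integral_abs_translate_le:
  fixes f :: "'a::euclidean_space \<Rightarrow> real"
  assumes f: "C_k (Suc n) f"
  shows "(\<integral>\<^sup>+z. ennreal \<bar>f (z + k) - f z\<bar> \<partial>lborel) \<le>
    ennreal (norm k) * (\<integral>\<^sup>+z. ennreal (onorm (frechet_derivative f (at z))) \<partial>lborel)"
proof -
  define g where "g z = onorm (frechet_derivative f (at z))" for z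
  have D: "(f has_derivative frechet_derivative f (at z)) (at z)" for z by (rule C_k_SucD[OF f])
  have g0: "g z \<ge> 0" for z
    unfolding g_def using D by (intro onorm_pos_le has_derivative_bounded_linear)
  have "continuous_on UNIV g" unfolding g_def by (rule continuous_on_onorm_frechet_derivative[OF f])
  then have [measurable]: "g \<in> borel_measurable borel" by (rule borel_measurable_continuous_onI)
  have pw: "ennreal \<bar>f (z + k) - f z\<bar> \<le> (\<integral>\<^sup>+t\<in>{0..1}. ennreal (norm k * g (z + t *\<^sub>R k)) \<partial>lborel)" for z
  proof -
    define h where "h t = frechet_derivative f (at (z + t *\<^sub>R k)) k" for t
    have "continuous_on UNIV (\<lambda>x. frechet_derivative f (at x) k)"
      using f C_k_continuous by auto
    then have hc: "continuous_on UNIV h" unfolding h_def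
      by (rule continuous_on_compose2) (auto intro!: continuous_intros)
    have hd: "((\<lambda>t. f (z + t *\<^sub>R k)) has_vector_derivative h t) (at t within {0..1})" for t
    proof -
      have "((\<lambda>t. f (z + t *\<^sub>R k)) has_derivative (\<lambda>s. frechet_derivative f (at (z + t *\<^sub>R k)) (s *\<^sub>R k))) (at t)"
        by (rule has_derivative_compose[OF _ D]) (auto intro!: derivative_eq_intros)
      then have "((\<lambda>t. f (z + t *\<^sub>R k)) has_derivative (\<lambda>s. s *\<^sub>R h t)) (at t)"
        unfolding h_def using has_derivative_linear[OF D] by (simp add: linear_scale)
      then show ?thesis unfolding has_vector_derivative_def by (rule has_derivative_at_withinI)
    qed
    have hi: "set_integrable lborel {0..1} h"
      by (rule borel_integrable_atLeastAtMost') (use hc continuous_on_subset in blast)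
    have FTC: "f (z + k) - f z = (\<integral>t. indicator {0..1} t *\<^sub>R h t \<partial>lborel)"
      using integral_FTC_atLeastAtMost[of 0 1 "\<lambda>t. f (z + t *\<^sub>R k)" h] hd hc continuous_on_subset by fastforce
    have "ennreal \<bar>f (z + k) - f z\<bar> \<le> (\<integral>\<^sup>+t. ennreal (norm (indicator {0..1} t *\<^sub>R h t)) \<partial>lborel)"
      unfolding FTC real_norm_def[symmetric]
      by (rule integral_norm_bound_ennreal) (use hi in \<open>simp add: set_integrable_def\<close>)
    also have "\<dots> \<le> (\<integral>\<^sup>+t\<in>{0..1}. ennreal (norm k * g (z + t *\<^sub>R k)) \<partial>lborel)"
    proof (rule nn_integral_mono)
      fix t :: real
      have "\<bar>h t\<bar> \<le> g (z + t *\<^sub>R k) * norm k"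
        unfolding h_def g_def real_norm_def[symmetric] by (rule onorm) (rule has_derivative_bounded_linear[OF D])
      then show "ennreal (norm (indicator {0..1} t *\<^sub>R h t)) \<le> ennreal (norm k * g (z + t *\<^sub>R k)) * indicator {0..1} t"
        by (auto simp: indicator_def mult.commute intro: ennreal_leI)
    qed
    finally show ?thesis .
  qed
  have "(\<integral>\<^sup>+z. ennreal \<bar>f (z + k) - f z\<bar> \<partial>lborel) \<le>
      (\<integral>\<^sup>+z. (\<integral>\<^sup>+t\<in>{0..1}. ennreal (norm k * g (z + t *\<^sub>R k)) \<partial>lborel) \<partial>lborel)"
    by (intro nn_integral_mono pw)
  also have "\<dots> = (\<integral>\<^sup>+t. (\<integral>\<^sup>+z. ennreal (norm k * g (z + t *\<^sub>R k)) * indicator {0..1} t \<partial>lborel) \<partial>lborel)"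
    by (rule lborel_pair.Fubini') measurable
  also have "\<dots> = (\<integral>\<^sup>+t. ennreal (norm k) * (\<integral>\<^sup>+z. ennreal (g z) \<partial>lborel) * indicator {0..1::real} t \<partial>lborel)"
  proof (rule nn_integral_cong)
    fix t :: real
    have "(\<integral>\<^sup>+z. ennreal (norm k * g (z + t *\<^sub>R k)) * indicator {0..1} t \<partial>lborel) =
        (\<integral>\<^sup>+z. ennreal (norm k * g (z + t *\<^sub>R k)) \<partial>lborel) * indicator {0..1} t"
      by (rule nn_integral_multc) measurable
    also have "(\<integral>\<^sup>+z. ennreal (norm k * g (z + t *\<^sub>R k)) \<partial>lborel) = (\<integral>\<^sup>+z. ennreal (norm k * g z) \<partial>lborel)"
      by (rule nn_integral_lborel_translate) measurable
    also have "\<dots> = ennreal (norm k) * (\<integral>\<^sup>+z. ennreal (g z) \<partial>lborel)"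
      using g0 by (simp add: ennreal_mult nn_integral_cmult)
    finally show "(\<integral>\<^sup>+z. ennreal (norm k * g (z + t *\<^sub>R k)) * indicator {0..1} t \<partial>lborel) =
        ennreal (norm k) * (\<integral>\<^sup>+z. ennreal (g z) \<partial>lborel) * indicator {0..1} t" .
  qed
  also have "\<dots> = ennreal (norm k) * (\<integral>\<^sup>+z. ennreal (g z) \<partial>lborel)"
    by (simp add: nn_integral_cmult_indicator)
  finally show ?thesis by (simp add: g_def)
qed

text \<open>Coarea formula with difference quotients in place of perimeters.\<close>

lemma nn_integral_jump_superlevel:
  fixes w :: "'a::euclidean_space \<Rightarrow> real"
  assumes [measurable]: "w \<in> borel_measurable borel" and w0: "\<And>x. w x \<ge> 0"
  shows "(\<integral>\<^sup>+s\<in>{0..}. (\<integral>\<^sup>+z. jump {x. s < w x} r z \<partial>lborel) \<partial>lborel) =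
    (\<integral>\<^sup>+k\<in>box (- (r *\<^sub>R One)) (r *\<^sub>R One). (\<integral>\<^sup>+z. ennreal \<bar>w (z + k) - w z\<bar> \<partial>lborel) \<partial>lborel)"
proof -
  define U :: "'a set" where "U = box (- (r *\<^sub>R One)) (r *\<^sub>R One)"
  have [measurable]: "U \<in> sets borel" by (simp add: U_def)
  define F :: "real \<Rightarrow> 'a \<Rightarrow> 'a \<Rightarrow> ennreal" where
    "F s z k = indicator U k * (if s \<ge> 0 \<and> (s < w z) \<noteq> (s < w (z + k)) then 1 else 0)" for s z k
  have jump: "jump {x. s < w x} r z * indicator {0..} s = (\<integral>\<^sup>+k. F s z k \<partial>lborel)" for s z
  proof -
    have m: "{k \<in> U. (s < w z) \<noteq> (s < w (z + k))} \<in> sets borel" by measurable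
    have "(\<integral>\<^sup>+k. F s z k \<partial>lborel) = (\<integral>\<^sup>+k. indicator {k \<in> U. (s < w z) \<noteq> (s < w (z + k))} k * indicator {0..} s \<partial>lborel)"
      by (intro nn_integral_cong) (auto simp: F_def indicator_def)
    also have "\<dots> = (\<integral>\<^sup>+k. indicator {k \<in> U. (s < w z) \<noteq> (s < w (z + k))} k \<partial>lborel) * indicator {0..} s"
      by (rule nn_integral_multc) (use m in simp)
    also have "\<dots> = jump {x. s < w x} r z * indicator {0..} s"
      using m by (simp add: jump_def U_def)
    finally show ?thesis ..
  qed
  \<comment> \<open>The levels separating \<open>w z\<close> from \<open>w (z + k)\<close> form an
    interval. As \<open>w\<close> is nonnegative, the restriction to \<open>s \<ge> 0\<close>
    removes none of it.\<close>
  have inner: "(\<integral>\<^sup>+s. F s z k \<partial>lborel) = indicator U k * ennreal \<bar>w (z + k) - w z\<bar>" for z k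
  proof -
    have "(\<integral>\<^sup>+s. F s z k \<partial>lborel) =
        (\<integral>\<^sup>+s. indicator U k * indicator {min (w z) (w (z + k))..<max (w z) (w (z + k))} s \<partial>lborel)"
      using w0[of z] w0[of "z + k"]
      by (intro nn_integral_cong) (auto simp: F_def indicator_def min_def max_def split: if_splits)
    also have "\<dots> = indicator U k * ennreal (max (w z) (w (z + k)) - min (w z) (w (z + k)))"
      by (subst nn_integral_cmult_indicator) auto
    also have "max (w z) (w (z + k)) - min (w z) (w (z + k)) = \<bar>w (z + k) - w z\<bar>" by auto
    finally show ?thesis .
  qed
  have "(\<integral>\<^sup>+s\<in>{0..}. (\<integral>\<^sup>+z. jump {x. s < w x} r z \<partial>lborel) \<partial>lborel) =
      (\<integral>\<^sup>+s. (\<integral>\<^sup>+z. (\<integral>\<^sup>+k. F s z k \<partial>lborel) \<partial>lborel) \<partial>lborel)"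
  proof (rule nn_integral_cong)
    fix s :: real
    have "{x. s < w x} \<in> sets borel" by measurable
    then have "(\<integral>\<^sup>+z. jump {x. s < w x} r z \<partial>lborel) * indicator {0..} s =
        (\<integral>\<^sup>+z. jump {x. s < w x} r z * indicator {0..} s \<partial>lborel)"
      by (intro nn_integral_multc[symmetric]) simp
    then show "(\<integral>\<^sup>+z. jump {x. s < w x} r z \<partial>lborel) * indicator {0..} s =
        (\<integral>\<^sup>+z. (\<integral>\<^sup>+k. F s z k \<partial>lborel) \<partial>lborel)" by (simp add: jump)
  qed
  also have "\<dots> = (\<integral>\<^sup>+z. (\<integral>\<^sup>+s. (\<integral>\<^sup>+k. F s z k \<partial>lborel) \<partial>lborel) \<partial>lborel)"
    unfolding F_def by (rule lborel_pair.Fubini') measurable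
  also have "\<dots> = (\<integral>\<^sup>+z. (\<integral>\<^sup>+k. (\<integral>\<^sup>+s. F s z k \<partial>lborel) \<partial>lborel) \<partial>lborel)"
    unfolding F_def by (intro nn_integral_cong lborel_pair.Fubini') measurable
  also have "\<dots> = (\<integral>\<^sup>+k. (\<integral>\<^sup>+z. indicator U k * ennreal \<bar>w (z + k) - w z\<bar> \<partial>lborel) \<partial>lborel)"
    unfolding inner by (rule lborel_pair.Fubini') measurable
  also have "\<dots> = (\<integral>\<^sup>+k\<in>U. (\<integral>\<^sup>+z. ennreal \<bar>w (z + k) - w z\<bar> \<partial>lborel) \<partial>lborel)"
    by (intro nn_integral_cong) (simp add: nn_integral_cmult mult.commute)
  finally show ?thesis by (simp add: U_def)
qed

text \<open>Layer cake formula: both sides are the product measure of the region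
  \<open>0 \<le> s \<and> s < w x\<close>.\<close>

lemma nn_integral_eq_superlevel:
  fixes w :: "'a::topological_space \<Rightarrow> real"
  assumes "sigma_finite_measure \<nu>" and sets [measurable_cong]: "sets \<nu> = sets borel"
    and [measurable]: "w \<in> borel_measurable borel" and w0: "\<And>x. w x \<ge> 0"
  shows "(\<integral>\<^sup>+x. ennreal (w x) \<partial>\<nu>) = (\<integral>\<^sup>+s\<in>{0..}. emeasure \<nu> {x. s < w x} \<partial>lborel)"
proof -
  interpret sigma_finite_measure \<nu> by fact
  interpret pair_sigma_finite \<nu> "lborel :: real measure" ..
  have "(\<integral>\<^sup>+x. ennreal (w x) \<partial>\<nu>) = (\<integral>\<^sup>+x. (\<integral>\<^sup>+s. (if 0 \<le> s \<and> s < w x then 1 else 0) \<partial>lborel) \<partial>\<nu>)"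
  proof (rule nn_integral_cong)
    fix x
    have "(\<integral>\<^sup>+s. (if 0 \<le> s \<and> s < w x then 1 else 0) \<partial>lborel) = (\<integral>\<^sup>+s. indicator {0..<w x} s \<partial>lborel)"
      by (intro nn_integral_cong) (auto simp: indicator_def)
    then show "ennreal (w x) = (\<integral>\<^sup>+s. (if 0 \<le> s \<and> s < w x then 1 else 0) \<partial>lborel)"
      using w0[of x] by simp
  qed
  also have "\<dots> = (\<integral>\<^sup>+s. (\<integral>\<^sup>+x. (if 0 \<le> s \<and> s < w x then 1 else 0) \<partial>\<nu>) \<partial>lborel)"
    by (rule Fubini'[symmetric]) measurable
  also have "\<dots> = (\<integral>\<^sup>+s\<in>{0..}. emeasure \<nu> {x. s < w x} \<partial>lborel)"
  proof (rule nn_integral_cong)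
    fix s :: real
    have m: "{x. s < w x} \<in> sets \<nu>" unfolding sets by measurable
    have "(\<integral>\<^sup>+x. (if 0 \<le> s \<and> s < w x then 1 else 0) \<partial>\<nu>) = (\<integral>\<^sup>+x. indicator {x. s < w x} x * indicator {0..} s \<partial>\<nu>)"
      by (intro nn_integral_cong) (auto simp: indicator_def)
    also have "\<dots> = emeasure \<nu> {x. s < w x} * indicator {0..} s"
      using m by (simp add: nn_integral_multc)
    finally show "(\<integral>\<^sup>+x. (if 0 \<le> s \<and> s < w x then 1 else 0) \<partial>\<nu>) = emeasure \<nu> {x. s < w x} * indicator {0..} s" .
  qed
  finally show ?thesis .
qed

text \<open>The estimate for open sets is applied to each superlevel set of the modulus of
  \<open>f\<close> and integrated over the level. Fatou's lemma takes the limit inferior outside,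
  the coarea formula and the translation estimate bound what remains uniformly in \<open>p\<close>,
  and the layer cake formula identifies the volume term.\<close>

lemma nn_integral_le_of_growth:
  fixes f :: "'a::euclidean_space \<Rightarrow> real"
  assumes fin: "finite_measure \<nu>" and sets [simp, measurable_cong]: "sets \<nu> = sets borel" and a: "a \<ge> 0"
    and growth: "\<And>j x. j \<ge> j0 \<Longrightarrow> emeasure \<nu> (dyadic_cube j x) \<le> ennreal (a * (1 / 2 ^ j) ^ (DIM('a) - 1))"
    and f: "C_k (Suc n) f"
  shows "(\<integral>\<^sup>+x. ennreal \<bar>f x\<bar> \<partial>\<nu>) \<le>
    ennreal (a * 4 ^ (DIM('a) + 1) * DIM('a)) * (\<integral>\<^sup>+z. ennreal (onorm (frechet_derivative f (at z))) \<partial>lborel)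
    + ennreal (2 * a * 2 ^ j0) * (\<integral>\<^sup>+z. ennreal \<bar>f z\<bar> \<partial>lborel)"
proof -
  let ?N = "DIM('a)"
  define w where "w x = \<bar>f x\<bar>" for x
  define G where "G = (\<integral>\<^sup>+z. ennreal (onorm (frechet_derivative f (at z))) \<partial>lborel)"
  define c where "c p = a * 2 ^ (?N + 2) * (2 ^ p) ^ (?N + 1)" for p :: nat
  define L where "L s p = ennreal (c p) * (\<integral>\<^sup>+z. jump {x. s < w x} (1 / 2 ^ p) z \<partial>lborel)" for s p
  have wc: "continuous_on UNIV w" unfolding w_def
    using C_k_continuous[OF f] by (intro continuous_intros)
  have [measurable]: "w \<in> borel_measurable borel" using wc by (rule borel_measurable_continuous_onI)
  have w0: "w x \<ge> 0" for x by (simp add: w_def)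
  have op: "open {x. s < w x}" for s
    using wc by (auto intro!: open_Collect_less continuous_intros)
  have jm: "(\<lambda>s. \<integral>\<^sup>+z. jump {x. s < w x} r z \<partial>lborel) \<in> borel_measurable borel" for r
  proof -
    have "(\<lambda>s. \<integral>\<^sup>+z. (\<integral>\<^sup>+k. (if k \<in> box (- (r *\<^sub>R One)) (r *\<^sub>R One) \<and> (s < w z) \<noteq> (s < w (z + k)) then 1 else 0) \<partial>lborel) \<partial>lborel)
      \<in> borel_measurable borel"
      by measurable
    moreover have "jump {x. s < w x} r z = (\<integral>\<^sup>+k. (if k \<in> box (- (r *\<^sub>R One)) (r *\<^sub>R One) \<and> (s < w z) \<noteq> (s < w (z + k)) then 1 else 0) \<partial>lborel)" for s z
    proof -
      have "{k \<in> box (- (r *\<^sub>R One)) (r *\<^sub>R One). (s < w z) \<noteq> (s < w (z + k))} \<in> sets lborel" by measurable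
      then have "jump {x. s < w x} r z = (\<integral>\<^sup>+k. indicator {k \<in> box (- (r *\<^sub>R One)) (r *\<^sub>R One). (s < w z) \<noteq> (s < w (z + k))} k \<partial>lborel)"
        by (simp add: jump_def)
      also have "\<dots> = (\<integral>\<^sup>+k. (if k \<in> box (- (r *\<^sub>R One)) (r *\<^sub>R One) \<and> (s < w z) \<noteq> (s < w (z + k)) then 1 else 0) \<partial>lborel)"
        by (intro nn_integral_cong) (simp add: indicator_def)
      finally show ?thesis .
    qed
    ultimately show ?thesis by simp
  qed
  then have Lm [measurable]: "(\<lambda>s. L s p) \<in> borel_measurable borel" for p
    unfolding L_def by measurable
  have em: "(\<lambda>s. emeasure lborel {x. s < w x}) \<in> borel_measurable borel"
  proof -
    have "{(s, x). s < w x} \<in> sets (borel \<Otimes>\<^sub>M lborel)"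
    proof -
      have "Measurable.pred (borel \<Otimes>\<^sub>M lborel) (\<lambda>y. fst y < w (snd y))" by measurable
      then show ?thesis by (simp add: pred_def space_pair_measure case_prod_unfold)
    qed
    from lborel.measurable_emeasure_Pair[OF this] show ?thesis by (simp add: vimage_def)
  qed
  \<comment> \<open>Displacements have norm at most \<open>?N * r\<close> and fill the volume
    \<open>(2 * r) ^ ?N\<close>. These powers of \<open>r\<close> cancel
    \<open>(2 ^ p) ^ (?N + 1)\<close> in \<open>c p\<close>, so the bound is free of
    \<open>p\<close>.\<close>
  have L_le: "(\<integral>\<^sup>+s\<in>{0..}. L s p \<partial>lborel) \<le> ennreal (a * 4 ^ (?N + 1) * ?N) * G" for p
  proof -
    define r :: real where "r = 1 / 2 ^ p"
    define U :: "'a set" where "U = box (- (r *\<^sub>R One)) (r *\<^sub>R One)"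
    have r: "r > 0" by (simp add: r_def)
    have U: "emeasure lborel U = ennreal ((2 * r) ^ ?N)"
    proof -
      have "(r *\<^sub>R One - - (r *\<^sub>R One)) \<bullet> b = 2 * r" if "b \<in> Basis" for b :: 'a
        using that by (simp add: inner_add_left)
      then have "(\<Prod>b\<in>Basis. (r *\<^sub>R One - - (r *\<^sub>R One)) \<bullet> (b::'a)) = (2 * r) ^ ?N" by simp
      then show ?thesis using r by (simp add: U_def emeasure_lborel_box_eq del: prod_constant)
    qed
    have nk: "norm k \<le> ?N * r" if "k \<in> U" for k
    proof -
      have "norm k \<le> (\<Sum>b\<in>Basis. \<bar>k \<bullet> b\<bar>)" by (rule norm_le_l1)
      also have "\<dots> \<le> (\<Sum>b\<in>(Basis::'a set). r)"
        using that by (intro sum_mono) (force simp: U_def mem_box abs_le_iff)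
      finally show ?thesis by simp
    qed
    have "(\<integral>\<^sup>+s\<in>{0..}. L s p \<partial>lborel) =
        ennreal (c p) * (\<integral>\<^sup>+s\<in>{0..}. (\<integral>\<^sup>+z. jump {x. s < w x} r z \<partial>lborel) \<partial>lborel)"
      using jm unfolding L_def r_def by (simp add: nn_integral_cmult mult.assoc)
    also have "(\<integral>\<^sup>+s\<in>{0..}. (\<integral>\<^sup>+z. jump {x. s < w x} r z \<partial>lborel) \<partial>lborel) =
        (\<integral>\<^sup>+k\<in>U. (\<integral>\<^sup>+z. ennreal \<bar>w (z + k) - w z\<bar> \<partial>lborel) \<partial>lborel)"
      unfolding U_def by (rule nn_integral_jump_superlevel) (use w0 in auto)
    also have "\<dots> \<le> (\<integral>\<^sup>+k. ennreal (?N * r) * G * indicator U k \<partial>lborel)"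
    proof (rule nn_integral_mono)
      fix k :: 'a
      have "(\<integral>\<^sup>+z. ennreal \<bar>w (z + k) - w z\<bar> \<partial>lborel) \<le> (\<integral>\<^sup>+z. ennreal \<bar>f (z + k) - f z\<bar> \<partial>lborel)"
        by (intro nn_integral_mono ennreal_leI) (simp add: w_def)
      also have "\<dots> \<le> ennreal (norm k) * G"
        unfolding G_def by (rule nn_integral_abs_translate_le[OF f])
      also have "\<dots> \<le> ennreal (?N * r) * G" if "k \<in> U"
        using nk[OF that] by (intro mult_right_mono ennreal_leI) auto
      finally show "(\<integral>\<^sup>+z. ennreal \<bar>w (z + k) - w z\<bar> \<partial>lborel) * indicator U k \<le> ennreal (?N * r) * G * indicator U k"
        by (auto simp: indicator_def)
    qed
    also have "\<dots> = ennreal (?N * r) * G * ennreal ((2 * r) ^ ?N)"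
      using U by (subst nn_integral_cmult_indicator) (auto simp: U_def)
    also have "ennreal (c p) * \<dots> = ennreal (c p * (?N * r) * (2 * r) ^ ?N) * G"
      using a r by (simp add: c_def ennreal_mult ac_simps)
    also have "c p * (?N * r) * (2 * r) ^ ?N = a * 4 ^ (?N + 1) * ?N"
    proof -
      have "(2 ^ p) ^ (?N + 1) * r ^ (?N + 1) = 1"
        by (simp add: r_def power_mult_distrib[symmetric])
      moreover have "(2::real) ^ (?N + 2) * 2 ^ ?N = 4 ^ (?N + 1)"
      proof -
        have "(4::real) ^ (?N + 1) = (2 * 2) ^ (?N + 1)" by simp
        then show ?thesis by (simp only: power_mult_distrib) simp
      qed
      moreover have "c p * (?N * r) * (2 * r) ^ ?N =
          a * ?N * ((2 ^ (?N + 2) * 2 ^ ?N) * ((2 ^ p) ^ (?N + 1) * r ^ (?N + 1)))"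
        by (simp add: c_def power_mult_distrib)
      ultimately show ?thesis by simp
    qed
    finally show ?thesis by (simp add: mult_left_mono)
  qed
  have "(\<integral>\<^sup>+x. ennreal \<bar>f x\<bar> \<partial>\<nu>) = (\<integral>\<^sup>+s\<in>{0..}. emeasure \<nu> {x. s < w x} \<partial>lborel)"
    using nn_integral_eq_superlevel[OF finite_measure.axioms(1)[OF fin] sets, of w] w0
    by (simp add: w_def)
  also have "\<dots> \<le> (\<integral>\<^sup>+s. (liminf (L s) * indicator {0..} s + ennreal (2 * a * 2 ^ j0) * (emeasure lborel {x. s < w x} * indicator {0..} s)) \<partial>lborel)"
  proof (rule nn_integral_mono)
    fix s :: real
    have "emeasure \<nu> {x. s < w x} \<le> liminf (L s) + ennreal (2 * a * 2 ^ j0) * emeasure lborel {x. s < w x}"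
      unfolding L_def c_def by (rule emeasure_open_le_liminf_jump[OF sets op a growth])
    then show "emeasure \<nu> {x. s < w x} * indicator {0..} s \<le>
        liminf (L s) * indicator {0..} s + ennreal (2 * a * 2 ^ j0) * (emeasure lborel {x. s < w x} * indicator {0..} s)"
      by (auto simp: indicator_def)
  qed
  also have "\<dots> = (\<integral>\<^sup>+s\<in>{0..}. liminf (L s) \<partial>lborel) +
      ennreal (2 * a * 2 ^ j0) * (\<integral>\<^sup>+s\<in>{0..}. emeasure lborel {x. s < w x} \<partial>lborel)"
    using em by (simp add: nn_integral_add nn_integral_cmult)
  also have "(\<integral>\<^sup>+s\<in>{0..}. emeasure lborel {x. s < w x} \<partial>lborel) = (\<integral>\<^sup>+z. ennreal \<bar>f z\<bar> \<partial>lborel)"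
    using nn_integral_eq_superlevel[OF lborel.sigma_finite_measure_axioms, of w] w0
    by (simp add: w_def)
  also have "(\<integral>\<^sup>+s\<in>{0..}. liminf (L s) \<partial>lborel) = (\<integral>\<^sup>+s. liminf (\<lambda>p. L s p * indicator {0..} s) \<partial>lborel)"
    by (intro nn_integral_cong) (auto simp: indicator_def Liminf_const)
  also have "\<dots> \<le> liminf (\<lambda>p. \<integral>\<^sup>+s\<in>{0..}. L s p \<partial>lborel)"
    by (rule nn_integral_liminf) measurable
  also have "\<dots> \<le> ennreal (a * 4 ^ (?N + 1) * ?N) * G"
    using L_le by (intro Liminf_le) auto
  finally show ?thesis unfolding G_def by (simp add: add_right_mono)
qed

section \<open>Hausdorff measure and dyadic density\<close>

lemma hausdorff_content_antimono:
  "\<delta> \<le> \<delta>' \<Longrightarrow> hausdorff_content s \<delta>' A \<le> hausdorff_content s \<delta> A"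
  unfolding hausdorff_content_def by (intro Inf_superset_mono) (blast intro: order_trans)

lemma hausdorff_content_mono:
  "A \<subseteq> B \<Longrightarrow> hausdorff_content s \<delta> A \<le> hausdorff_content s \<delta> B"
  unfolding hausdorff_content_def by (intro Inf_superset_mono) (blast intro: order_trans)

text \<open>Smaller \<open>\<delta>\<close> admits fewer covers, so the content is monotone and
  converges to its supremum. The limit has to be exhibited because \<open>Lim\<close> is meaningful
  only where one exists.\<close>

lemma hausdorff_measure_eq_SUP: "hausdorff_measure s A = (SUP \<delta>\<in>{0<..}. hausdorff_content s \<delta> A)"
  unfolding hausdorff_measure_def
proof (rule tendsto_Lim)
  show "((\<lambda>\<delta>. hausdorff_content s \<delta> A) \<longlongrightarrow> (SUP \<delta>\<in>{0<..}. hausdorff_content s \<delta> A)) (at_right 0)"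
  proof (rule order_tendstoI)
    fix y assume "y < (SUP \<delta>\<in>{0<..}. hausdorff_content s \<delta> A)"
    then obtain d where d: "d > 0" "y < hausdorff_content s d A" by (auto simp: less_SUP_iff)
    have "y < hausdorff_content s \<delta> A" if "\<delta> < d" for \<delta>
      using hausdorff_content_antimono[of \<delta> d s A] d that by (auto intro: less_le_trans)
    then show "\<forall>\<^sub>F \<delta> in at_right 0. y < hausdorff_content s \<delta> A"
      unfolding eventually_at_right_field using d(1) by blast
  next
    fix y assume y: "(SUP \<delta>\<in>{0<..}. hausdorff_content s \<delta> A) < y"
    have "hausdorff_content s \<delta> A < y" if "\<delta> > 0" for \<delta>
      using that by (intro le_less_trans[OF SUP_upper y]) simp
    then show "\<forall>\<^sub>F \<delta> in at_right 0. hausdorff_content s \<delta> A < y"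
      unfolding eventually_at_right_field using zero_less_one by blast
  qed
qed (rule trivial_limit_at_right_real)

lemma hausdorff_content_le_measure: "\<delta> > 0 \<Longrightarrow> hausdorff_content s \<delta> A \<le> hausdorff_measure s A"
  unfolding hausdorff_measure_eq_SUP by (rule SUP_upper) simp

lemma hausdorff_measure_mono: "A \<subseteq> B \<Longrightarrow> hausdorff_measure s A \<le> hausdorff_measure s B"
  unfolding hausdorff_measure_eq_SUP by (intro SUP_mono) (use hausdorff_content_mono in blast)

text \<open>Unused members of the sequence of balls get radius 0; they are empty and cost nothing,
  also for \<open>s = 0\<close>.\<close>

lemma hausdorff_content_le_nn_integral:
  assumes I: "countable I" and cover: "A \<subseteq> (\<Union>i\<in>I. ball (x i) (r i))"
    and r: "\<And>i. i \<in> I \<Longrightarrow> 0 \<le> r i \<and> r i \<le> \<delta>" and "0 \<le> \<delta>"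
  shows "hausdorff_content s \<delta> A \<le> (\<integral>\<^sup>+i. ennreal (unit_ball_vol s * r i powr s) \<partial>count_space I)"
proof -
  define J where "J = to_nat_on I ` I"
  have bij: "bij_betw (to_nat_on I) I J" using I by (simp add: J_def bij_betw_def inj_on_to_nat_on)
  define x' where "x' n = x (from_nat_into I n)" for n
  define r' where "r' n = (if n \<in> J then r (from_nat_into I n) else 0)" for n
  have fi: "from_nat_into I (to_nat_on I i) = i" if "i \<in> I" for i using I that by simp
  have "A \<subseteq> (\<Union>n. ball (x' n) (r' n))"
  proof
    fix y assume "y \<in> A"
    then obtain i where i: "i \<in> I" "y \<in> ball (x i) (r i)" using cover by blast
    then have "y \<in> ball (x' (to_nat_on I i)) (r' (to_nat_on I i))"
      by (simp add: x'_def r'_def fi J_def)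
    then show "y \<in> (\<Union>n. ball (x' n) (r' n))" by blast
  qed
  moreover have "0 \<le> r' n \<and> r' n \<le> \<delta>" for n
    using r \<open>0 \<le> \<delta>\<close> by (auto simp: r'_def J_def fi)
  ultimately have "hausdorff_content s \<delta> A \<le> (\<Sum>n. ennreal (unit_ball_vol s * r' n powr s))"
    unfolding hausdorff_content_def by (intro Inf_lower) blast
  also have "\<dots> = (\<integral>\<^sup>+n. ennreal (unit_ball_vol s * r' n powr s) \<partial>count_space UNIV)"
    by (rule nn_integral_count_space_nat[symmetric])
  also have "\<dots> = (\<integral>\<^sup>+n. ennreal (unit_ball_vol s * r' n powr s) \<partial>count_space J)"
    by (subst nn_integral_count_space_indicator[of J])
      (auto simp: r'_def indicator_def intro!: nn_integral_cong)
  also have "\<dots> = (\<integral>\<^sup>+i. ennreal (unit_ball_vol s * r' (to_nat_on I i) powr s) \<partial>count_space I)"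
    by (rule nn_integral_bij_count_space[OF bij, symmetric])
  also have "\<dots> = (\<integral>\<^sup>+i. ennreal (unit_ball_vol s * r i powr s) \<partial>count_space I)"
    by (intro nn_integral_cong) (simp add: r'_def J_def fi)
  finally show ?thesis .
qed

text \<open>The cubes that violate the growth condition of the trace inequality with constant
  \<open>a\<close>.\<close>

definition dense_cube :: "'a::euclidean_space measure \<Rightarrow> real \<Rightarrow> nat \<Rightarrow> 'a \<Rightarrow> bool" where
  "dense_cube \<nu> a j x \<longleftrightarrow> ennreal (a * (1 / 2 ^ j) ^ (DIM('a) - 1)) < emeasure \<nu> (dyadic_cube j x)"

lemma dense_cube_cong: "y \<in> dyadic_cube j x \<Longrightarrow> dense_cube \<nu> a j y \<longleftrightarrow> dense_cube \<nu> a j x"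
  using dyadic_cube_eq[of y j x] by (simp add: dense_cube_def)

lemma borel_dense_cube [measurable]: "{x. dense_cube \<nu> a j x} \<in> sets borel"
proof -
  have "{x. dense_cube \<nu> a j x} = \<Union>(dyadic_cube j ` {x. dense_cube \<nu> a j x})"
  proof (intro equalityI subsetI)
    fix x assume "x \<in> \<Union>(dyadic_cube j ` {x. dense_cube \<nu> a j x})"
    then obtain y where "dense_cube \<nu> a j y" "x \<in> dyadic_cube j y" by blast
    then show "x \<in> {x. dense_cube \<nu> a j x}" using dense_cube_cong[of x j y \<nu> a] by simp
  qed (use mem_dyadic_cube_self in blast)
  also have "\<dots> \<in> sets borel"
    by (intro sets.countable_Union countable_subset[OF _ countable_dyadic_cubes]) auto
  finally show ?thesis .
qed

text \<open>The maximal dense cubes from a fine scale on are disjoint and cover the set. Density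
  bounds the cost of each by a multiple of its mass, so the total cost is at most a multiple of
  \<open>emeasure \<nu> UNIV\<close>, the same for every \<open>\<delta>\<close>.\<close>

lemma hausdorff_measure_dense_finite:
  fixes \<nu> :: "'a::euclidean_space measure"
  assumes fin: "finite_measure \<nu>" and sets: "sets \<nu> = sets borel" and a: "a > 0"
  shows "hausdorff_measure (real DIM('a) - 1) {x. \<forall>m. \<exists>j\<ge>m. dense_cube \<nu> a j x} < \<infinity>"
proof -
  interpret finite_measure \<nu> by fact
  let ?N = "DIM('a)"
  let ?D = "{x. \<forall>m. \<exists>j\<ge>m. dense_cube \<nu> a j x}"
  define s :: real where "s = real ?N - 1"
  have sN: "s = real (?N - 1)" using DIM_positive[where 'a='a] by (simp add: s_def of_nat_diff)
  have s: "t powr s = t ^ (?N - 1)" if "t > 0" for t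
    unfolding sN using that by (rule powr_realpow)
  define c where "c = unit_ball_vol s * (?N + 1) ^ (?N - 1) / a"
  have ubv: "unit_ball_vol s \<ge> 0" using DIM_positive[where 'a='a] by (intro unit_ball_vol_nonneg) (simp add: sN)
  have c: "c \<ge> 0" using a ubv by (simp add: c_def)
  have "hausdorff_content s \<delta> ?D \<le> ennreal c * emeasure \<nu> UNIV" if \<delta>: "\<delta> > 0" for \<delta>
  proof -
    \<comment> \<open>From this scale on the balls around the cubes have radius at most
      \<open>\<delta>\<close>.\<close>
    obtain m where m: "(?N + 1) / \<delta> < 2 ^ m" using real_arch_pow[of 2 "(?N + 1) / \<delta>"] by auto
    let ?\<C> = "stopping_cubes (dense_cube \<nu> a) m UNIV"
    have count: "countable ?\<C>" by (rule countable_stopping_cubes)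
    have "\<forall>Q\<in>?\<C>. \<exists>j x. m \<le> j \<and> Q = dyadic_cube j x \<and> dense_cube \<nu> a j x"
      unfolding stopping_cubes_def by blast
    then obtain J X where JX: "\<And>Q. Q \<in> ?\<C> \<Longrightarrow> m \<le> J Q \<and> Q = dyadic_cube (J Q) (X Q) \<and> dense_cube \<nu> a (J Q) (X Q)"
      by metis
    \<comment> \<open>Points of \<open>Q\<close> are at distance at most
      \<open>?N / 2 ^ J Q\<close>; the added 1 lets an open ball contain the cube.\<close>
    define r where "r Q = (?N + 1) / 2 ^ J Q" for Q
    have r0: "r Q > 0" for Q by (simp add: r_def add_pos_pos)
    have "hausdorff_content s \<delta> ?D \<le> (\<integral>\<^sup>+Q. ennreal (unit_ball_vol s * r Q powr s) \<partial>count_space ?\<C>)"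
    proof (rule hausdorff_content_le_nn_integral[OF count])
      have "?D \<subseteq> \<Union>?\<C>"
        using stopping_cubes_cover[of "dense_cube \<nu> a", where J = UNIV] by blast
      moreover have "Q \<subseteq> ball (X Q) (r Q)" if Q: "Q \<in> ?\<C>" for Q
      proof
        fix y assume "y \<in> Q"
        then have "y \<in> dyadic_cube (J Q) (X Q)" using JX[OF Q] by blast
        then have "dist (X Q) y \<le> ?N / 2 ^ J Q" by (rule dist_dyadic_cube[OF mem_dyadic_cube_self])
        also have "\<dots> < r Q" by (simp add: r_def divide_strict_right_mono)
        finally show "y \<in> ball (X Q) (r Q)" by simp
      qed
      ultimately show "?D \<subseteq> (\<Union>Q\<in>?\<C>. ball (X Q) (r Q))" by blast
      show "0 \<le> r Q \<and> r Q \<le> \<delta>" if Q: "Q \<in> ?\<C>" for Q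
      proof -
        have "r Q \<le> (?N + 1) / 2 ^ m" unfolding r_def
          using JX[OF Q] by (intro divide_left_mono power_increasing) auto
        also have "\<dots> \<le> \<delta>" using m \<delta> by (simp add: field_simps)
        finally show ?thesis using r0[of Q] by simp
      qed
    qed (use \<delta> in simp)
    also have "\<dots> \<le> (\<integral>\<^sup>+Q. ennreal c * emeasure \<nu> Q \<partial>count_space ?\<C>)"
    proof (rule nn_integral_mono)
      fix Q assume "Q \<in> space (count_space ?\<C>)"
      then have Q: "Q \<in> ?\<C>" by simp
      have "unit_ball_vol s * r Q powr s = c * (a * (1 / 2 ^ J Q) ^ (?N - 1))"
        using a s[OF r0] by (simp add: c_def r_def power_divide)
      also have "ennreal \<dots> = ennreal c * ennreal (a * (1 / 2 ^ J Q) ^ (?N - 1))"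
        using c a by (intro ennreal_mult) auto
      also have "\<dots> \<le> ennreal c * emeasure \<nu> Q"
        using JX[OF Q] unfolding dense_cube_def by (intro mult_left_mono) (auto intro: less_imp_le)
      finally show "ennreal (unit_ball_vol s * r Q powr s) \<le> ennreal c * emeasure \<nu> Q" .
    qed
    also have "\<dots> = ennreal c * (\<integral>\<^sup>+Q. emeasure \<nu> Q \<partial>count_space ?\<C>)"
      by (simp add: nn_integral_cmult)
    also have "(\<integral>\<^sup>+Q. emeasure \<nu> Q \<partial>count_space ?\<C>) = emeasure \<nu> (\<Union>Q\<in>?\<C>. Q)"
    proof (rule emeasure_UN_countable[symmetric])
      show "disjoint_family_on (\<lambda>Q. Q) ?\<C>"
        using disjoint_stopping_cubes[where P = "dense_cube \<nu> a" and m = m and J = UNIV, OF dense_cube_cong]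
        unfolding disjoint_family_on_def disjoint_def by simp
      show "Q \<in> sets \<nu>" if "Q \<in> ?\<C>" for Q
        using that stopping_cubes_borel sets by blast
    qed (rule count)
    also have "\<dots> \<le> emeasure \<nu> UNIV"
      by (intro emeasure_mono) (use sets in \<open>auto simp: sets_eq_imp_space_eq\<close>)
    finally show ?thesis by (simp add: mult_left_mono)
  qed
  then have "hausdorff_measure s ?D \<le> ennreal c * emeasure \<nu> UNIV"
    unfolding hausdorff_measure_eq_SUP by (intro SUP_least) simp
  also have "\<dots> < \<infinity>" by (simp add: ennreal_mult_less_top emeasure_eq_measure)
  finally show ?thesis by (simp add: s_def)
qed

section \<open>Norms of compactly supported smooth functions\<close>

lemma smooth_C_k: "smooth f \<Longrightarrow> C_k k f"
  by (simp add: smooth_def)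

context
  fixes f :: "'a::euclidean_space \<Rightarrow> real"
  assumes f: "smooth f" and K: "compact (supp f)"
begin

lemma zero_outside_supp: "x \<notin> supp f \<Longrightarrow> f x = 0"
  unfolding supp_def using closure_subset[of "{x. f x \<noteq> 0}"] by auto

lemma frechet_derivative_zero_outside_supp:
  assumes "x \<notin> supp f"
  shows "frechet_derivative f (at x) = (\<lambda>_. 0)"
proof -
  have "open (- supp f)" unfolding supp_def by (rule open_Compl[OF closed_closure])
  then have "(f has_derivative (\<lambda>_. 0)) (at x)"
    using assms zero_outside_supp
    by (intro has_derivative_transform_within_open[of "\<lambda>_. 0" "\<lambda>_. 0" x UNIV "- supp f" f]) auto
  from frechet_derivative_at[OF this] show ?thesis by simp
qed

lemma integrable_of_continuous_supp:
  fixes g :: "'a \<Rightarrow> real"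
  assumes "continuous_on UNIV g" "\<And>x. x \<notin> supp f \<Longrightarrow> g x = 0"
  shows "integrable lborel g"
proof -
  have "integrable lborel (\<lambda>x. indicator (supp f) x *\<^sub>R g x)"
    using borel_integrable_compact[OF K] assms(1) continuous_on_subset by blast
  moreover have "(\<lambda>x. indicator (supp f) x *\<^sub>R g x) = g"
    using assms(2) by (auto simp: indicator_def fun_eq_iff)
  ultimately show ?thesis by simp
qed

lemma smooth_continuous: "continuous_on UNIV f"
  using C_k_continuous[OF smooth_C_k[OF f]] .

lemma integrable_smooth: "integrable lborel f"
  using smooth_continuous zero_outside_supp by (rule integrable_of_continuous_supp)

lemma integrable_onorm_frechet_derivative: "integrable lborel (\<lambda>x. onorm (frechet_derivative f (at x)))"
  by (rule integrable_of_continuous_supp)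
    (auto simp: frechet_derivative_zero_outside_supp onorm_zero
      intro: continuous_on_onorm_frechet_derivative[OF smooth_C_k[OF f]])

lemma onorm_frechet_derivative_nonneg: "onorm (frechet_derivative f (at x)) \<ge> 0"
  using C_k_SucD[OF smooth_C_k[OF f]] by (intro onorm_pos_le has_derivative_bounded_linear)

lemma smooth_bounded: "\<exists>B. \<forall>x. \<bar>f x\<bar> \<le> B"
proof -
  have "compact (f ` supp f)"
    using smooth_continuous K continuous_on_subset by (intro compact_continuous_image) auto
  then have "bounded (f ` supp f)" by (rule compact_imp_bounded)
  then obtain B where B: "\<forall>y\<in>f ` supp f. norm y \<le> B" unfolding bounded_iff by blast
  have "\<bar>f x\<bar> \<le> max B 0" for x
    using B zero_outside_supp[of x] by (cases "x \<in> supp f") auto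
  then show ?thesis by blast
qed

text \<open>An essential bound of a continuous function holds everywhere, since a nonempty open set
  is not negligible. Boundedness excludes an infinite essential supremum, which
  \<open>real_of_ereal\<close> would send to 0.\<close>

lemma abs_le_Linf_norm: "\<bar>f x\<bar> \<le> Linf_norm f"
proof -
  obtain B where B: "\<And>x. \<bar>f x\<bar> \<le> B" using smooth_bounded by blast
  have [measurable]: "f \<in> borel_measurable borel"
    using smooth_continuous by (rule borel_measurable_continuous_onI)
  define S where "S = esssup lborel (\<lambda>x. ereal \<bar>f x\<bar>)"
  have "S \<le> ereal B" unfolding S_def
    by (rule esssup_I) (use B in auto)
  have ae: "AE x in lborel. ereal \<bar>f x\<bar> \<le> S" unfolding S_def by (rule esssup_AE)
  have le: "ereal \<bar>f x\<bar> \<le> S" for x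
  proof (rule ccontr)
    assume x: "\<not> ereal \<bar>f x\<bar> \<le> S"
    then obtain t where t: "S < ereal t" "t < \<bar>f x\<bar>"
      using ereal_dense2[of S "ereal \<bar>f x\<bar>"] by (auto simp: not_le)
    define V where "V = {y. t < \<bar>f y\<bar>}"
    have V: "open V" "x \<in> V" unfolding V_def using smooth_continuous t
      by (auto intro!: open_Collect_less continuous_intros)
    have "AE y in lborel. y \<notin> V"
      using ae by eventually_elim (use t in \<open>auto simp: V_def not_less\<close>, metis ereal_less_eq(3) less_le_not_le less_le_trans linorder_not_less order_less_imp_le)
    then have "emeasure lborel V = 0"
      using V(1) by (subst (asm) AE_iff_measurable[of V]) auto
    then have "V \<in> null_sets lborel" using V(1) by auto
    then have "negligible V" by (simp add: negligible_iff_null_sets null_sets_completionI)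
    then show False using V open_not_negligible by blast
  qed
  have "0 \<le> S" using le[of x] by (metis abs_ge_zero ereal_less_eq(5) order_trans)
  then have "ereal (real_of_ereal S) = S"
    using \<open>S \<le> ereal B\<close> by (intro ereal_real') auto
  then show ?thesis using le[of x] unfolding Linf_norm_def S_def by (metis ereal_less_eq(3))
qed

lemma Linf_norm_nonneg: "Linf_norm f \<ge> 0"
  using abs_le_Linf_norm[of undefined] by linarith

lemma nn_integral_L1_norm: "(\<integral>\<^sup>+x. ennreal \<bar>f x\<bar> \<partial>lborel) = ennreal (L1_norm f)"
  unfolding L1_norm_def using integrable_smooth by (intro nn_integral_eq_integral) auto

lemma nn_integral_L1_norm_deriv:
  "(\<integral>\<^sup>+x. ennreal (onorm (frechet_derivative f (at x))) \<partial>lborel) = ennreal (L1_norm_deriv f)"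
  unfolding L1_norm_deriv_def
  using integrable_onorm_frechet_derivative onorm_frechet_derivative_nonneg by (intro nn_integral_eq_integral) auto

end

text \<open>The sets \<open>F m\<close> decrease to one of finite Hausdorff measure, which is null,
  so some \<open>F m\<close> has mass below \<open>\<epsilon>\<close>. On it the sup norm pays; on
  the complement the trace inequality applies.\<close>

lemma integral_le_of_hausdorff_null:
  fixes \<nu> :: "'a::euclidean_space measure"
  assumes fin: "finite_measure \<nu>" and sets [measurable_cong]: "sets \<nu> = sets borel"
    and null: "\<And>A. A \<in> sets borel \<Longrightarrow> hausdorff_measure (real DIM('a) - 1) A < \<infinity> \<Longrightarrow> emeasure \<nu> A = 0"
    and \<epsilon>: "\<epsilon> > 0"
  shows "\<exists>C>0. \<forall>\<phi>. smooth \<phi> \<longrightarrow> compact (supp \<phi>) \<longrightarrow>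
    \<bar>integral\<^sup>L \<nu> \<phi>\<bar> \<le> C * L1_norm \<phi> + \<epsilon> * (L1_norm_deriv \<phi> + Linf_norm \<phi>)"
proof -
  interpret finite_measure \<nu> by fact
  let ?N = "DIM('a)"
  have space: "space \<nu> = UNIV" using sets_eq_imp_space_eq[OF sets] by simp
  \<comment> \<open>Makes the gradient constant of the trace inequality equal to
    \<open>\<epsilon>\<close>.\<close>
  define a where "a = \<epsilon> / (4 ^ (?N + 1) * ?N)"
  have a: "a > 0" "a * 4 ^ (?N + 1) * ?N = \<epsilon>" using \<epsilon> by (simp_all add: a_def)
  define F where "F m = {x. \<exists>j\<ge>m. dense_cube \<nu> a j x}" for m
  have Fm [measurable]: "F m \<in> sets borel" for m
  proof -
    have "F m = (\<Union>j\<in>{m..}. {x. dense_cube \<nu> a j x})" by (auto simp: F_def)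
    then show ?thesis by simp
  qed
  have "emeasure \<nu> (\<Inter>m. F m) = 0"
  proof (rule null)
    have "(\<Inter>m. F m) = {x. \<forall>m. \<exists>j\<ge>m. dense_cube \<nu> a j x}" unfolding F_def by blast
    then show "hausdorff_measure (real ?N - 1) (\<Inter>m. F m) < \<infinity>"
      using hausdorff_measure_dense_finite[OF fin sets a(1)] by (simp only:)
    show "(\<Inter>m. F m) \<in> sets borel" by (intro sets.countable_INT'') (use Fm in auto)
  qed
  moreover have "(\<lambda>m. measure \<nu> (F m)) \<longlonglongrightarrow> measure \<nu> (\<Inter>m. F m)"
  proof (rule finite_Lim_measure_decseq)
    show "range F \<subseteq> sets \<nu>" using sets Fm by blast
    show "decseq F" unfolding decseq_def F_def using order_trans by blast
  qed
  ultimately have "(\<lambda>m. measure \<nu> (F m)) \<longlonglongrightarrow> 0" by (simp add: measure_def)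
  then obtain m where m: "measure \<nu> (F m) < \<epsilon>"
    using \<epsilon> order_tendstoD(2) eventually_happens by (metis sequentially_bot)
  define \<nu>' where "\<nu>' = density \<nu> (indicator (- F m))"
  have sets' [simp]: "sets \<nu>' = sets borel" using sets by (simp add: \<nu>'_def)
  have \<nu>': "emeasure \<nu>' A = emeasure \<nu> (- F m \<inter> A)" if "A \<in> sets borel" for A
    unfolding \<nu>'_def using that sets Fm by (intro emeasure_restricted) auto
  have fin': "finite_measure \<nu>'"
  proof
    have "space \<nu>' = UNIV" using space by (simp add: \<nu>'_def)
    then show "emeasure \<nu>' (space \<nu>') \<noteq> \<infinity>" by (simp add: \<nu>' emeasure_eq_measure)
  qed
  \<comment> \<open>A cube of scale at least \<open>m\<close> that meets the complement of
    \<open>F m\<close> is not dense; one that does not meet it has no mass under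
    \<open>\<nu>'\<close>.\<close>
  have growth: "emeasure \<nu>' (dyadic_cube j x) \<le> ennreal (a * (1 / 2 ^ j) ^ (?N - 1))" if "j \<ge> m" for j x
  proof (cases "- F m \<inter> dyadic_cube j x = {}")
    case False
    then obtain y where y: "y \<notin> F m" "y \<in> dyadic_cube j x" by blast
    have "emeasure \<nu>' (dyadic_cube j x) \<le> emeasure \<nu> (dyadic_cube j x)"
      unfolding \<nu>'[OF dyadic_cube_borel] by (rule emeasure_mono) (auto simp: sets)
    also have "\<dots> \<le> ennreal (a * (1 / 2 ^ j) ^ (?N - 1))"
      using y(1) that dense_cube_cong[OF y(2), of \<nu> a] by (auto simp: F_def dense_cube_def not_less)
    finally show ?thesis .
  qed (simp add: \<nu>')
  define C where "C = 2 * a * 2 ^ m"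
  have C: "C > 0" using a by (simp add: C_def)
  have "\<bar>integral\<^sup>L \<nu> \<phi>\<bar> \<le> C * L1_norm \<phi> + \<epsilon> * (L1_norm_deriv \<phi> + Linf_norm \<phi>)"
    if \<phi>: "smooth \<phi>" "compact (supp \<phi>)" for \<phi>
  proof -
    have [measurable]: "\<phi> \<in> borel_measurable borel"
      using smooth_continuous[OF \<phi>] by (rule borel_measurable_continuous_onI)
    have n0: "L1_norm \<phi> \<ge> 0" "L1_norm_deriv \<phi> \<ge> 0" "Linf_norm \<phi> \<ge> 0"
      using onorm_frechet_derivative_nonneg[OF \<phi>] Linf_norm_nonneg[OF \<phi>]
      by (auto simp: L1_norm_def L1_norm_deriv_def)
    have int: "integrable \<nu> \<phi>"
      using abs_le_Linf_norm[OF \<phi>] by (intro integrable_const_bound[where B = "Linf_norm \<phi>"]) auto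
    have "ennreal \<bar>integral\<^sup>L \<nu> \<phi>\<bar> \<le> (\<integral>\<^sup>+x. ennreal \<bar>\<phi> x\<bar> \<partial>\<nu>)"
      using integral_norm_bound_ennreal[OF int] by simp
    also have "\<dots> = (\<integral>\<^sup>+x. indicator (- F m) x * ennreal \<bar>\<phi> x\<bar> + ennreal \<bar>\<phi> x\<bar> * indicator (F m) x \<partial>\<nu>)"
      by (intro nn_integral_cong) (auto simp: indicator_def)
    also have "\<dots> = (\<integral>\<^sup>+x. indicator (- F m) x * ennreal \<bar>\<phi> x\<bar> \<partial>\<nu>) + (\<integral>\<^sup>+x\<in>F m. ennreal \<bar>\<phi> x\<bar> \<partial>\<nu>)"
      by (intro nn_integral_add) measurable
    also have "(\<integral>\<^sup>+x. indicator (- F m) x * ennreal \<bar>\<phi> x\<bar> \<partial>\<nu>) = (\<integral>\<^sup>+x. ennreal \<bar>\<phi> x\<bar> \<partial>\<nu>')"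
      unfolding \<nu>'_def by (subst nn_integral_density) auto
    also have "\<dots> \<le> ennreal \<epsilon> * ennreal (L1_norm_deriv \<phi>) + ennreal C * ennreal (L1_norm \<phi>)"
      unfolding a(2)[symmetric] C_def nn_integral_L1_norm[OF \<phi>, symmetric] nn_integral_L1_norm_deriv[OF \<phi>, symmetric]
      by (rule nn_integral_le_of_growth[OF fin' sets' less_imp_le[OF a(1)] growth smooth_C_k[OF \<phi>(1)]])
    also have "(\<integral>\<^sup>+x\<in>F m. ennreal \<bar>\<phi> x\<bar> \<partial>\<nu>) \<le> (\<integral>\<^sup>+x. ennreal (Linf_norm \<phi>) * indicator (F m) x \<partial>\<nu>)"
      using abs_le_Linf_norm[OF \<phi>] by (intro nn_integral_mono mult_right_mono ennreal_leI) auto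
    also have "\<dots> = ennreal (Linf_norm \<phi> * measure \<nu> (F m))"
      using n0 sets by (subst nn_integral_cmult_indicator) (auto simp: emeasure_eq_measure ennreal_mult)
    also have "\<dots> \<le> ennreal (Linf_norm \<phi> * \<epsilon>)"
      using m n0 by (intro ennreal_leI mult_left_mono) auto
    also have "ennreal \<epsilon> * ennreal (L1_norm_deriv \<phi>) + ennreal C * ennreal (L1_norm \<phi>) + ennreal (Linf_norm \<phi> * \<epsilon>) =
        ennreal (C * L1_norm \<phi> + \<epsilon> * (L1_norm_deriv \<phi> + Linf_norm \<phi>))"
      using n0 \<epsilon> C by (simp add: ennreal_mult[symmetric] ennreal_plus[symmetric] algebra_simps del: ennreal_plus)
    finally have "ennreal \<bar>integral\<^sup>L \<nu> \<phi>\<bar> \<le> ennreal (C * L1_norm \<phi> + \<epsilon> * (L1_norm_deriv \<phi> + Linf_norm \<phi>))"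
      by (simp add: add_left_mono add_right_mono)
    then show ?thesis
      using n0 \<epsilon> C by (subst (asm) ennreal_le_iff) auto
  qed
  with C show ?thesis by blast
qed

section \<open>Bump functions adapted to a covering by balls\<close>

lemma C_k_const: "C_k k (\<lambda>x. c)"
proof (induction k arbitrary: c)
  case (Suc k)
  show ?case by (rule C_k_SucI[where D = "\<lambda>_ _. 0"]) (auto intro: Suc)
qed simp

lemma C_k_add: "C_k k f \<Longrightarrow> C_k k g \<Longrightarrow> C_k k (\<lambda>x. f x + g x)"
proof (induction k arbitrary: f g)
  case 0
  then show ?case by (simp add: continuous_on_add)
next
  case (Suc k)
  show ?case
    by (rule C_k_SucI[OF has_derivative_add[OF C_k_SucD[OF Suc.prems(1)] C_k_SucD[OF Suc.prems(2)]]])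
      (use Suc in auto)
qed

lemma C_k_mult: "C_k k f \<Longrightarrow> C_k k g \<Longrightarrow> C_k k (\<lambda>x. f x * g x)"
proof (induction k arbitrary: f g)
  case 0
  then show ?case by (simp add: continuous_on_mult)
next
  case (Suc k)
  show ?case
  proof (rule C_k_SucI[OF has_derivative_mult[OF C_k_SucD[OF Suc.prems(1)] C_k_SucD[OF Suc.prems(2)]]])
    fix v
    have "C_k k f" "C_k k g" using Suc.prems C_k_Suc_imp_C_k by blast+
    moreover have "C_k k (\<lambda>x. frechet_derivative f (at x) v)" "C_k k (\<lambda>x. frechet_derivative g (at x) v)"
      using Suc.prems by auto
    ultimately show "C_k k (\<lambda>x. f x * frechet_derivative g (at x) v + frechet_derivative f (at x) v * g x)"
      by (intro C_k_add Suc.IH)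
  qed
qed

lemma smooth_one_minus:
  assumes "smooth f"
  shows "smooth (\<lambda>x. 1 - f x)"
proof -
  have "C_k k (\<lambda>x. 1 + (-1) * f x)" for k
    using assms by (intro C_k_add C_k_mult C_k_const smooth_C_k)
  then show ?thesis by (simp add: smooth_def)
qed

lemma smooth_prod: "(\<And>i. i \<in> I \<Longrightarrow> smooth (f i)) \<Longrightarrow> smooth (\<lambda>x. \<Prod>i\<in>I. f i x)"
  by (induction I rule: infinite_finite_induct) (auto simp: smooth_def C_k_const C_k_mult)

lemma poly_exp_tendsto_0: "((\<lambda>u::real. poly q u * exp (- u)) \<longlongrightarrow> 0) at_top"
proof -
  have "((\<lambda>u::real. \<Sum>i\<le>degree q. coeff q i * (u ^ i / exp u)) \<longlongrightarrow> (\<Sum>i\<le>degree q. coeff q i * 0)) at_top"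
    by (intro tendsto_sum tendsto_mult_left tendsto_power_div_exp_0)
  moreover have "(\<Sum>i\<le>degree q. coeff q i * (u ^ i / exp u)) = poly q u * exp (- u)" for u
    by (simp add: poly_altdef sum_divide_distrib exp_minus divide_inverse sum_distrib_right mult.assoc)
  ultimately show ?thesis by simp
qed

text \<open>The function \<open>q(1/t) exp(-1/t)\<close>, extended by 0 to \<open>t \<le> 0\<close>: letting the polynomial \<open>q\<close> vary
  makes the family closed under differentiation.\<close>

definition flat :: "real poly \<Rightarrow> real \<Rightarrow> real" where
  "flat q t = (if t > 0 then poly q (1 / t) * exp (- (1 / t)) else 0)"

text \<open>With u = 1/t the chain rule gives u^2 (q - q')(u) exp(-u) for positive t. At 0 the
  exponential beats every polynomial.\<close>

lemma flat_has_real_derivative: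
  "(flat q has_real_derivative flat (monom 1 2 * (q - pderiv q)) t) (at t)"
proof -
  consider "t > 0" | "t < 0" | "t = 0" by linarith
  then show ?thesis
  proof cases
    case 1
    have "((\<lambda>t. poly q (1 / t) * exp (- (1 / t))) has_real_derivative flat (monom 1 2 * (q - pderiv q)) t) (at t)"
    proof -
      have inv: "((\<lambda>t. 1 / t) has_real_derivative - (1 / t\<^sup>2)) (at t)"
        using 1 by (auto intro!: derivative_eq_intros simp: power2_eq_square)
      have ex: "((\<lambda>t. exp (- (1 / t))) has_real_derivative exp (- (1 / t)) * (1 / t\<^sup>2)) (at t)"
        using DERIV_chain2[OF DERIV_exp DERIV_minus[OF inv]] by simp
      have eq: "flat (monom 1 2 * (q - pderiv q)) t =
          (1 / t\<^sup>2) * (poly q (1 / t) - poly (pderiv q) (1 / t)) * exp (- (1 / t))"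
        using 1 by (simp add: flat_def poly_monom power_one_over)
      show ?thesis unfolding eq
        by (rule DERIV_cong[OF DERIV_mult[OF DERIV_chain2[OF poly_DERIV[of q] inv] ex]])
          (simp add: algebra_simps diff_divide_distrib)
    qed
    then show ?thesis
      by (rule has_field_derivative_transform_within_open[of _ _ _ "{0<..}"]) (use 1 in \<open>auto simp: flat_def\<close>)
  next
    case 2
    have "((\<lambda>_. 0) has_real_derivative 0) (at t)" by simp
    then have "(flat q has_real_derivative 0) (at t)"
      by (rule has_field_derivative_transform_within_open[of _ _ _ "{..<0}"]) (use 2 in \<open>auto simp: flat_def\<close>)
    then show ?thesis using 2 by (simp add: flat_def)
  next
    case 3
    \<comment> \<open>Dividing by \<open>h = 1 / u\<close> multiplies by \<open>u\<close>, and
      \<open>pCons 0 q\<close> is \<open>q\<close> times its variable.\<close>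
    have "((\<lambda>u. poly (pCons 0 q) u * exp (- u)) \<longlongrightarrow> 0) at_top" by (rule poly_exp_tendsto_0)
    moreover have "\<forall>\<^sub>F u in at_top. poly (pCons 0 q) u * exp (- u) = flat q (inverse u) / inverse u"
      using eventually_gt_at_top[of 0] by eventually_elim (simp add: flat_def field_simps)
    ultimately have "((\<lambda>u. flat q (inverse u) / inverse u) \<longlongrightarrow> 0) at_top"
      by (rule Lim_transform_eventually)
    then have right: "((\<lambda>h. flat q h / h) \<longlongrightarrow> 0) (at_right 0)"
      by (simp add: filterlim_at_right_to_top)
    have "\<forall>\<^sub>F h in at_left 0. flat q h / h = 0"
      unfolding eventually_at_left_field by (intro exI[of _ "-1"]) (simp add: flat_def)
    then have left: "((\<lambda>h. flat q h / h) \<longlongrightarrow> 0) (at_left 0)"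
      by (rule tendsto_eventually)
    have "((\<lambda>h. flat q h / h) \<longlongrightarrow> 0) (at 0)"
      using left right by (simp add: filterlim_at_split)
    then show ?thesis using 3 by (simp add: DERIV_def flat_def)
  qed
qed

text \<open>The induction runs over all \<open>q\<close> at once, since differentiation changes the
  polynomial.\<close>

lemma C_k_flat_compose: "smooth f \<Longrightarrow> C_k k (\<lambda>x. flat q (f x))"
proof (induction k arbitrary: q)
  case 0
  have "continuous_on UNIV (flat q)"
    by (intro continuous_at_imp_continuous_on ballI DERIV_isCont[OF flat_has_real_derivative])
  then show ?case
    using C_k_continuous[OF smooth_C_k[OF 0]] by (simp add: continuous_on_compose2)
next
  case (Suc k)
  have "(f has_derivative frechet_derivative f (at x)) (at x)" for x
    by (rule C_k_SucD[OF smooth_C_k[OF Suc.prems]])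
  from DERIV_compose_FDERIV[OF flat_has_real_derivative this]
  show ?case
  proof (rule C_k_SucI)
    fix v
    have "C_k (Suc k) f" by (rule smooth_C_k[OF Suc.prems])
    then have "C_k k (\<lambda>x. frechet_derivative f (at x) v)" by simp
    then show "C_k k (\<lambda>x. frechet_derivative f (at x) v * flat (monom 1 2 * (q - pderiv q)) (f x))"
      by (intro C_k_mult Suc.IH Suc.prems)
  qed
qed

lemma C_k_inner: "C_k k (\<lambda>x. c * ((x - x0) \<bullet> v))"
proof (cases k)
  case (Suc n)
  show ?thesis unfolding Suc
    by (rule C_k_SucI[where D = "\<lambda>_ w. c * (w \<bullet> v)"]) (auto intro!: derivative_eq_intros C_k_const)
qed (auto intro!: continuous_intros)

text \<open>For positive \<open>r\<close> this is exp(-1/(4 - |x - x0|^2/r^2)) within distance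
  \<open>2 * r\<close> of \<open>x0\<close> and 0 beyond. The squared distance, unlike the distance,
  is smooth at the centre.\<close>

definition bump :: "'a::euclidean_space \<Rightarrow> real \<Rightarrow> 'a \<Rightarrow> real" where
  "bump x0 r x = flat 1 (4 - ((x - x0) \<bullet> (x - x0)) / r\<^sup>2)"

lemma bump_argument_has_derivative:
  "((\<lambda>x. 4 - ((x - x0) \<bullet> (x - x0)) / r\<^sup>2) has_derivative (\<lambda>v. (- 2 / r\<^sup>2) * ((x - x0) \<bullet> v))) (at x)"
proof -
  have "((\<lambda>x. 4 - c * ((x - x0) \<bullet> (x - x0))) has_derivative (\<lambda>v. (- 2 * c) * ((x - x0) \<bullet> v))) (at x)" for c
    by (auto intro!: derivative_eq_intros simp: inner_commute algebra_simps)
  from this[of "1 / r\<^sup>2"] show ?thesis by simp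
qed

lemma smooth_bump: "smooth (bump x0 r)"
proof -
  have "C_k (Suc k) (\<lambda>x. 4 - ((x - x0) \<bullet> (x - x0)) / r\<^sup>2)" for k
    by (rule C_k_SucI[OF bump_argument_has_derivative C_k_inner])
  then have "smooth (\<lambda>x. 4 - ((x - x0) \<bullet> (x - x0)) / r\<^sup>2)"
    unfolding smooth_def using C_k_Suc_imp_C_k by blast
  then have "\<forall>k. C_k k (\<lambda>x. flat 1 (4 - ((x - x0) \<bullet> (x - x0)) / r\<^sup>2))"
    by (intro allI C_k_flat_compose)
  then show ?thesis unfolding smooth_def bump_def[abs_def] .
qed

lemma bump_nonneg: "0 \<le> bump x0 r x"
  by (simp add: bump_def flat_def)

lemma bump_le_1: "bump x0 r x \<le> 1"
  by (simp add: bump_def flat_def)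

lemma bump_argument_nonpos:
  assumes "r > 0" "2 * r \<le> dist x0 x"
  shows "4 - ((x - x0) \<bullet> (x - x0)) / r\<^sup>2 \<le> 0"
proof -
  have "(2 * r)\<^sup>2 \<le> (dist x0 x)\<^sup>2" using assms by (intro power_mono) auto
  then show ?thesis using assms(1)
    by (simp add: dist_commute dist_norm field_simps power_mult_distrib flip: power2_norm_eq_inner)
qed

lemma bump_ge:
  assumes "r > 0" "x \<in> ball x0 r"
  shows "exp (- (1 / 3)) \<le> bump x0 r x"
proof -
  define t where "t = 4 - ((x - x0) \<bullet> (x - x0)) / r\<^sup>2"
  have "(dist x0 x)\<^sup>2 \<le> r\<^sup>2" using assms by (intro power_mono) auto
  then have t: "t \<ge> 3" using assms(1)
    by (simp add: t_def dist_commute dist_norm field_simps flip: power2_norm_eq_inner)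
  then have "1 / t \<le> 1 / 3" by (simp add: field_simps)
  then show ?thesis using t by (simp add: bump_def flat_def flip: t_def)
qed

lemma bump_has_derivative:
  "(bump x0 r has_derivative
    (\<lambda>v. (- 2 / r\<^sup>2) * ((x - x0) \<bullet> v) * flat (monom 1 2) (4 - ((x - x0) \<bullet> (x - x0)) / r\<^sup>2))) (at x)"
  using DERIV_compose_FDERIV[OF flat_has_real_derivative[of 1] bump_argument_has_derivative[of x0 r x]]
  unfolding bump_def[abs_def] by simp

text \<open>\<open>flat (monom 1 2)\<close> is the derivative of \<open>flat 1\<close>. With u = 1/t
  it becomes u^2 exp(-u), and exp(u) is at least u^2/2.\<close>

lemma flat_monom_bounds: "0 \<le> flat (monom 1 2) t" "flat (monom 1 2) t \<le> 2"
proof -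
  have "u\<^sup>2 * exp (- u) \<le> 2" if "u > 0" for u :: real
  proof -
    have "u\<^sup>2 / 2 \<le> exp u" using exp_lower_Taylor_quadratic[of u] that by simp
    then show ?thesis by (simp add: exp_minus field_simps)
  qed
  from this[of "1 / t"] show "flat (monom 1 2) t \<le> 2"
    by (simp add: flat_def poly_monom)
qed (simp add: flat_def poly_monom)

text \<open>On the doubled ball the factors are at most \<open>2 / r\<^sup>2\<close>,
  \<open>2 * r * norm v\<close> and 2, whence \<open>8 / r\<close>; outside it \<open>flat\<close>
  vanishes.\<close>

lemma bump_derivative_le:
  assumes r: "r > 0"
  shows "\<bar>(- 2 / r\<^sup>2) * ((x - x0) \<bullet> v) * flat (monom 1 2) (4 - ((x - x0) \<bullet> (x - x0)) / r\<^sup>2)\<bar>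
    \<le> 8 / r * indicator (cball x0 (2 * r)) x * norm v"
proof (cases "x \<in> cball x0 (2 * r)")
  case True
  have "\<bar>(x - x0) \<bullet> v\<bar> \<le> norm (x - x0) * norm v" by (rule Cauchy_Schwarz_ineq2)
  also have "\<dots> \<le> (2 * r) * norm v"
    using True by (intro mult_right_mono) (auto simp: dist_norm norm_minus_commute)
  finally have 1: "\<bar>(x - x0) \<bullet> v\<bar> \<le> 2 * r * norm v" .
  define A where "A = flat (monom 1 2) (4 - ((x - x0) \<bullet> (x - x0)) / r\<^sup>2)"
  have A: "0 \<le> A" "A \<le> 2" unfolding A_def by (rule flat_monom_bounds)+
  have "\<bar>(- 2 / r\<^sup>2) * ((x - x0) \<bullet> v) * A\<bar> = 2 / r\<^sup>2 * (\<bar>(x - x0) \<bullet> v\<bar> * A)"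
    using A by (simp add: abs_mult)
  also have "\<dots> \<le> 2 / r\<^sup>2 * ((2 * r * norm v) * 2)"
    using 1 A r by (intro mult_left_mono mult_mono) auto
  also have "\<dots> = 8 / r * norm v" using r by (simp add: field_simps power2_eq_square)
  finally show ?thesis using True by (simp add: A_def)
next
  case False
  then have "4 - ((x - x0) \<bullet> (x - x0)) / r\<^sup>2 \<le> 0" by (intro bump_argument_nonpos r) simp
  then show ?thesis using False by (simp add: flat_def)
qed

text \<open>A smooth substitute for the maximum of the bumps. Unlike their sum it stays below 1
  however many balls overlap, and its gradient norm is still at most the sum of theirs.\<close>

definition bump_cover :: "'i set \<Rightarrow> ('i \<Rightarrow> 'a::euclidean_space) \<Rightarrow> ('i \<Rightarrow> real) \<Rightarrow> 'a \<Rightarrow> real" where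
  "bump_cover I X r x = 1 - (\<Prod>i\<in>I. 1 - bump (X i) (r i) x)"

context
  fixes I :: "'i set" and X :: "'i \<Rightarrow> 'a::euclidean_space" and r :: "'i \<Rightarrow> real"
  assumes I: "finite I" and r: "\<And>i. i \<in> I \<Longrightarrow> r i > 0"
begin

lemma smooth_bump_cover: "smooth (bump_cover I X r)"
  unfolding bump_cover_def[abs_def] by (intro smooth_one_minus smooth_prod smooth_bump)

lemma bump_cover_bounds: "0 \<le> bump_cover I X r x" "bump_cover I X r x \<le> 1"
  using bump_nonneg bump_le_1
  by (auto simp: bump_cover_def intro!: prod_le_1 prod_nonneg)

text \<open>The other factors lie between 0 and 1, so the product is at most the factor belonging to
  the ball around \<open>x\<close>.\<close>

lemma bump_cover_ge:
  assumes "i \<in> I" "x \<in> ball (X i) (r i)"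
  shows "exp (- (1 / 3)) \<le> bump_cover I X r x"
proof -
  have "(\<Prod>j\<in>I. 1 - bump (X j) (r j) x) = (1 - bump (X i) (r i) x) * (\<Prod>j\<in>I - {i}. 1 - bump (X j) (r j) x)"
    using I assms(1) by (rule prod.remove)
  also have "\<dots> \<le> (1 - bump (X i) (r i) x) * 1"
    using bump_nonneg bump_le_1 by (intro mult_left_mono prod_le_1) auto
  finally show ?thesis using bump_ge[OF r assms(2)] assms(1) by (simp add: bump_cover_def)
qed

lemma bump_cover_le: "bump_cover I X r x \<le> (\<Sum>i\<in>I. indicator (cball (X i) (2 * r i)) x)"
proof (cases "\<exists>i\<in>I. x \<in> cball (X i) (2 * r i)")
  case True
  then obtain i where i: "i \<in> I" "x \<in> cball (X i) (2 * r i)" by blast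
  have "bump_cover I X r x \<le> indicator (cball (X i) (2 * r i)) x"
    using bump_cover_bounds i by simp
  also have "\<dots> \<le> (\<Sum>i\<in>I. indicator (cball (X i) (2 * r i)) x)"
    using I i(1) by (intro member_le_sum) auto
  finally show ?thesis .
next
  case False
  then have "bump (X i) (r i) x = 0" if "i \<in> I" for i
    using bump_argument_nonpos[OF r[OF that], of "X i" x] that by (auto simp: bump_def flat_def)
  then have "bump_cover I X r x = 0" by (simp add: bump_cover_def)
  then show ?thesis by (simp add: sum_nonneg)
qed

lemma supp_bump_cover: "supp (bump_cover I X r) \<subseteq> (\<Union>i\<in>I. cball (X i) (2 * r i))"
  unfolding supp_def
proof (rule closure_minimal)
  show "{x. bump_cover I X r x \<noteq> 0} \<subseteq> (\<Union>i\<in>I. cball (X i) (2 * r i))"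
  proof
    fix x assume "x \<in> {x. bump_cover I X r x \<noteq> 0}"
    then have "(\<Sum>i\<in>I. indicator (cball (X i) (2 * r i)) x :: real) \<noteq> 0"
      using bump_cover_le[of x] bump_cover_bounds(1)[of x] by auto
    then show "x \<in> (\<Union>i\<in>I. cball (X i) (2 * r i))"
      by (metis (mono_tags, lifting) UN_I indicator_simps(2) sum.neutral)
  qed
qed (use I in auto)

lemma cball_weight_nonneg: "i \<in> I \<Longrightarrow> 0 \<le> 8 / r i * (indicator (cball (X i) (2 * r i)) x :: real)"
  by (intro mult_nonneg_nonneg divide_nonneg_pos r) auto

text \<open>In the product rule each derivative is multiplied by a cofactor between 0 and 1, so the
  bounds for the single bumps add up.\<close>

lemma onorm_bump_cover_le:
  "onorm (frechet_derivative (bump_cover I X r) (at x)) \<le> (\<Sum>i\<in>I. 8 / r i * indicator (cball (X i) (2 * r i)) x)"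
proof -
  define D where "D i v = (- 2 / (r i)\<^sup>2) * ((x - X i) \<bullet> v) *
    flat (monom 1 2) (4 - ((x - X i) \<bullet> (x - X i)) / (r i)\<^sup>2)" for i v
  define P where "P i = (\<Prod>j\<in>I - {i}. 1 - bump (X j) (r j) x)" for i
  have D: "((\<lambda>x. 1 - bump (X i) (r i) x) has_derivative (\<lambda>v. 0 - D i v)) (at x)" for i
    unfolding D_def by (intro has_derivative_diff has_derivative_const bump_has_derivative)
  have "(bump_cover I X r has_derivative (\<lambda>v. 0 - (\<Sum>i\<in>I. (0 - D i v) * P i))) (at x)"
    unfolding bump_cover_def[abs_def] P_def by (intro has_derivative_diff has_derivative_const has_derivative_prod D)
  then have eq: "frechet_derivative (bump_cover I X r) (at x) = (\<lambda>v. 0 - (\<Sum>i\<in>I. (0 - D i v) * P i))"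
    by (rule frechet_derivative_at[symmetric])
  show ?thesis unfolding eq
  proof (rule onorm_bound)
    show "0 \<le> (\<Sum>i\<in>I. 8 / r i * indicator (cball (X i) (2 * r i)) x)"
      by (rule sum_nonneg) (rule cball_weight_nonneg)
    fix v
    have P: "0 \<le> P i" "P i \<le> 1" for i
      unfolding P_def by (auto intro!: prod_nonneg prod_le_1 simp: bump_nonneg bump_le_1)
    have "norm (0 - (\<Sum>i\<in>I. (0 - D i v) * P i)) \<le> (\<Sum>i\<in>I. \<bar>(0 - D i v) * P i\<bar>)"
      by simp (rule sum_abs[THEN order_trans], simp)
    also have "\<dots> \<le> (\<Sum>i\<in>I. 8 / r i * indicator (cball (X i) (2 * r i)) x * norm v)"
    proof (rule sum_mono)
      fix i assume i: "i \<in> I"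
      have "\<bar>(0 - D i v) * P i\<bar> \<le> \<bar>D i v\<bar> * 1"
        using P[of i] by (simp add: abs_mult mult_left_le)
      also have "\<dots> \<le> 8 / r i * indicator (cball (X i) (2 * r i)) x * norm v"
        unfolding D_def using bump_derivative_le[OF r[OF i]] by simp
      finally show "\<bar>(0 - D i v) * P i\<bar> \<le> 8 / r i * indicator (cball (X i) (2 * r i)) x * norm v" .
    qed
    finally show "norm (0 - (\<Sum>i\<in>I. (0 - D i v) * P i)) \<le>
        (\<Sum>i\<in>I. 8 / r i * indicator (cball (X i) (2 * r i)) x) * norm v"
      by (simp add: sum_distrib_right)
  qed
qed

lemma integral_weighted_cballs:
  "integrable lborel (\<lambda>x. \<Sum>i\<in>I. c i * indicator (cball (X i) (2 * r i)) x)" (is "integrable _ ?f")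
  "(LINT x|lborel. (\<Sum>i\<in>I. c i * indicator (cball (X i) (2 * r i)) x)) =
    (\<Sum>i\<in>I. c i * (unit_ball_vol DIM('a) * (2 * r i) ^ DIM('a)))"
proof -
  have int: "integrable lborel (\<lambda>x. c i * indicator (cball (X i) (2 * r i)) x)" for i
    by (rule integrable_mult_right, rule integrable_real_indicator) (simp, rule emeasure_lborel_cball_finite)
  then show "integrable lborel ?f" by (intro Bochner_Integration.integrable_sum)
  have "(LINT x|lborel. ?f x) = (\<Sum>i\<in>I. LINT x|lborel. c i * indicator (cball (X i) (2 * r i)) x)"
    using int by (intro Bochner_Integration.integral_sum)
  also have "\<dots> = (\<Sum>i\<in>I. c i * (unit_ball_vol DIM('a) * (2 * r i) ^ DIM('a)))"
    by (intro sum.cong refl) (use r in \<open>simp add: content_cball less_imp_le\<close>)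
  finally show "(LINT x|lborel. ?f x) = (\<Sum>i\<in>I. c i * (unit_ball_vol DIM('a) * (2 * r i) ^ DIM('a)))" .
qed

lemma L1_norm_bump_cover_le:
  "L1_norm (bump_cover I X r) \<le> (\<Sum>i\<in>I. unit_ball_vol DIM('a) * (2 * r i) ^ DIM('a))"
proof -
  have "L1_norm (bump_cover I X r) \<le> (LINT x|lborel. (\<Sum>i\<in>I. 1 * indicator (cball (X i) (2 * r i)) x))"
    unfolding L1_norm_def using bump_cover_le bump_cover_bounds
    by (intro integral_mono' integral_weighted_cballs(1)) (auto intro: sum_nonneg)
  then show ?thesis using integral_weighted_cballs(2)[of "\<lambda>_. 1"] by simp
qed

lemma L1_norm_deriv_bump_cover_le:
  "L1_norm_deriv (bump_cover I X r) \<le> (\<Sum>i\<in>I. 8 / r i * (unit_ball_vol DIM('a) * (2 * r i) ^ DIM('a)))"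
proof -
  have "L1_norm_deriv (bump_cover I X r) \<le> (LINT x|lborel. (\<Sum>i\<in>I. 8 / r i * indicator (cball (X i) (2 * r i)) x))"
    unfolding L1_norm_deriv_def
    by (intro integral_mono' integral_weighted_cballs(1) onorm_bump_cover_le sum_nonneg cball_weight_nonneg)
  then show ?thesis unfolding integral_weighted_cballs(2) .
qed

lemma Linf_norm_bump_cover_le: "Linf_norm (bump_cover I X r) \<le> 1"
proof -
  have [measurable]: "bump_cover I X r \<in> borel_measurable borel"
    by (rule borel_measurable_continuous_onI[OF C_k_continuous[OF smooth_C_k[OF smooth_bump_cover]]])
  have "esssup lborel (\<lambda>x. ereal \<bar>bump_cover I X r x\<bar>) \<le> ereal 1"
    by (rule esssup_I) (use bump_cover_bounds in auto)
  then show ?thesis unfolding Linf_norm_def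
    by (cases "esssup lborel (\<lambda>x. ereal \<bar>bump_cover I X r x\<bar>)") auto
qed

end

section \<open>Testing the charge estimate on compact sets of finite Hausdorff measure\<close>

text \<open>The bump function of an economical cover of \<open>L\<close> by balls of radius at most
  \<open>\<delta>\<close> is at least exp(-1/3) on \<open>L\<close>, lives near \<open>L\<close>,
  has bounded gradient in L1 and an L1 norm of order \<open>\<delta>\<close>. The choices are made
  in the order \<open>\<epsilon>\<close>, \<open>C\<close>, \<open>\<delta>\<close>, so that the
  term with \<open>C\<close> can be made small.\<close>

lemma measure_le_of_charge_estimate:
  fixes p q :: "'a::euclidean_space measure"
  assumes p: "finite_measure p" "sets p = sets borel" and q: "finite_measure q" "sets q = sets borel"
    and charge: "\<And>\<epsilon> K. \<epsilon> > 0 \<Longrightarrow> compact K \<Longrightarrow> \<exists>C>0. \<forall>\<phi>. smooth \<phi> \<longrightarrow> supp \<phi> \<subseteq> K \<longrightarrow>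
      integral\<^sup>L p \<phi> - integral\<^sup>L q \<phi> \<le> C * L1_norm \<phi> + \<epsilon> * (L1_norm_deriv \<phi> + Linf_norm \<phi>)"
    and L: "compact L" "hausdorff_measure (real DIM('a) - 1) L < \<infinity>"
  shows "exp (- (1 / 3)) * measure p L \<le> measure q L"
proof (cases "L = {}")
  case False
  interpret p: finite_measure p by fact
  interpret q: finite_measure q by fact
  note [measurable_cong] = p(2) q(2)
  let ?N = "DIM('a)"
  have N: "real ?N - 1 = real (?N - 1)" using DIM_positive[where 'a='a] by (simp add: of_nat_diff)
  \<comment> \<open>The strict inequality lets the infimum defining the content yield an actual
    cover costing less than \<open>h\<close>.\<close>
  obtain h where h: "h > 0" "hausdorff_measure (real ?N - 1) L < ennreal h"
  proof -
    obtain h' where "hausdorff_measure (real ?N - 1) L = ennreal h'" "h' \<ge> 0"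
      using L(2) by (cases "hausdorff_measure (real ?N - 1) L") auto
    then show ?thesis using that[of "h' + 1"] by (simp add: ennreal_less_iff)
  qed
  define \<omega> where "\<omega> = unit_ball_vol (real ?N - 1)"
  define v where "v = unit_ball_vol (real ?N) * 2 ^ ?N"
  define H where "H = h / \<omega>"
  have \<omega>: "\<omega> > 0" unfolding \<omega>_def N by (rule unit_ball_vol_pos) simp
  have v: "v > 0" unfolding v_def by (simp add: unit_ball_vol_pos)
  have H: "H > 0" using h \<omega> by (simp add: H_def)
  show ?thesis
  proof (rule field_le_epsilon)
    fix e :: real assume e: "e > 0"
    \<comment> \<open>\<open>8 * v * H\<close> and 1 will bound the gradient and sup norms, so these
      terms together cost at most \<open>e / 3\<close>.\<close>
    define \<epsilon> where "\<epsilon> = e / (3 * (8 * v * H + 1))"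
    have pos: "8 * v * H + 1 > 0" using v H by (simp add: add_pos_pos)
    have \<epsilon>: "\<epsilon> > 0" "\<epsilon> * (8 * v * H + 1) = e / 3"
      using e pos by (simp_all add: \<epsilon>_def field_simps)
    \<comment> \<open>The 3 leaves room for doubled balls: if a ball of radius at most
      \<open>1 / Suc n\<close> meets \<open>L\<close>, its double stays within three radii of
      \<open>L\<close>.\<close>
    define nb where "nb n = {x. infdist x L \<le> 3 / Suc n}" for n
    have nb_closed: "closed (nb n)" for n
      unfolding nb_def by (intro closed_Collect_le continuous_intros)
    \<comment> \<open>The largest neighbourhood serves as the compact set, so \<open>C\<close> does
      not depend on the cover chosen later.\<close>
    have "compact (nb 0)" unfolding nb_def using False L(1) by (intro compact_infdist_le) auto
    from charge[OF \<epsilon>(1) this] obtain C where C: "C > 0"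
      "\<And>\<phi>. smooth \<phi> \<Longrightarrow> supp \<phi> \<subseteq> nb 0 \<Longrightarrow>
        integral\<^sup>L p \<phi> - integral\<^sup>L q \<phi> \<le> C * L1_norm \<phi> + \<epsilon> * (L1_norm_deriv \<phi> + Linf_norm \<phi>)"
      by blast
    have nb_antimono: "nb n \<subseteq> nb m" if "m \<le> n" for m n
    proof -
      have "3 / real (Suc n) \<le> 3 / real (Suc m)" using that by (intro divide_left_mono) auto
      then show ?thesis unfolding nb_def by auto
    qed
    have "(\<Inter>n. nb n) = L"
    proof
      show "(\<Inter>n. nb n) \<subseteq> L"
      proof
        fix x assume x: "x \<in> (\<Inter>n. nb n)"
        have "(\<lambda>n. 3 * (1 / real (Suc n))) \<longlonglongrightarrow> 3 * 0"
          by (intro tendsto_intros LIMSEQ_Suc[OF lim_1_over_n])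
        then have "infdist x L \<le> 3 * 0"
          by (rule LIMSEQ_le_const) (use x in \<open>auto simp: nb_def\<close>)
        then have "infdist x L = 0" using infdist_nonneg[of x L] by simp
        then show "x \<in> L" using in_closed_iff_infdist_zero[of L x] L(1) False compact_imp_closed by blast
      qed
      show "L \<subseteq> (\<Inter>n. nb n)" by (auto simp: nb_def)
    qed
    moreover have "(\<lambda>n. measure q (nb n)) \<longlonglongrightarrow> measure q (\<Inter>n. nb n)"
      by (rule q.finite_Lim_measure_decseq) (use nb_closed nb_antimono q(2) in \<open>auto simp: decseq_def\<close>)
    ultimately have "(\<lambda>n. measure q (nb n)) \<longlonglongrightarrow> measure q L" by simp
    then have ev1: "\<forall>\<^sub>F n in sequentially. measure q (nb n) < measure q L + e / 3"
      by (rule order_tendstoD) (use e in simp)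
    have "(\<lambda>n. C * v * H * (1 / real (Suc n))) \<longlonglongrightarrow> C * v * H * 0"
      by (intro tendsto_intros LIMSEQ_Suc[OF lim_1_over_n])
    then have ev2: "\<forall>\<^sub>F n in sequentially. C * v * H * (1 / real (Suc n)) < e / 3"
      by (rule order_tendstoD) (use e in simp)
    obtain n where n: "measure q (nb n) < measure q L + e / 3" "C * v * H * (1 / real (Suc n)) < e / 3"
      using eventually_happens[OF eventually_conj[OF ev1 ev2]] by auto
    define \<delta> where "\<delta> = 1 / real (Suc n)"
    have \<delta>: "\<delta> > 0" by (simp add: \<delta>_def)
    have "hausdorff_content (real ?N - 1) \<delta> L < ennreal h"
      using hausdorff_content_le_measure[OF \<delta>] h(2) by (rule le_less_trans)
    then obtain X r where X: "L \<subseteq> (\<Union>n. ball (X n) (r n))" "\<And>n. 0 \<le> r n" "\<And>n. r n \<le> \<delta>"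
      "(\<Sum>n::nat. ennreal (\<omega> * r n powr (real ?N - 1))) < ennreal h"
      unfolding hausdorff_content_def Inf_less_iff \<omega>_def by blast
    \<comment> \<open>Balls missing \<open>L\<close> are dropped. Those kept are nonempty, so they
      have positive radius, and their doubles stay in \<open>nb n\<close>.\<close>
    define J where "J = {n. ball (X n) (r n) \<inter> L \<noteq> {}}"
    have "L \<subseteq> (\<Union>n\<in>J. ball (X n) (r n))" using X(1) unfolding J_def by blast
    then obtain I where I: "I \<subseteq> J" "finite I" "L \<subseteq> (\<Union>n\<in>I. ball (X n) (r n))"
      using compactE_image[OF L(1), of J "\<lambda>n. ball (X n) (r n)"] by blast
    have r0: "r i > 0" if "i \<in> I" for i
    proof -
      have "ball (X i) (r i) \<noteq> {}" using I(1) that unfolding J_def by blast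
      then show ?thesis by (simp add: ball_eq_empty)
    qed
    have "ennreal (\<Sum>i\<in>I. \<omega> * r i ^ (?N - 1)) = (\<Sum>i\<in>I. ennreal (\<omega> * r i powr (real ?N - 1)))"
    proof -
      have eq: "\<omega> * r i powr (real ?N - 1) = \<omega> * r i ^ (?N - 1)" if "i \<in> I" for i
        by (simp only: N powr_realpow[OF r0[OF that]])
      have "(\<Sum>i\<in>I. ennreal (\<omega> * r i powr (real ?N - 1))) = (\<Sum>i\<in>I. ennreal (\<omega> * r i ^ (?N - 1)))"
        by (intro sum.cong refl) (simp only: eq)
      also have "\<dots> = ennreal (\<Sum>i\<in>I. \<omega> * r i ^ (?N - 1))"
        using \<omega> X(2) by (intro sum_ennreal) simp
      finally show ?thesis ..
    qed
    also have "\<dots> \<le> (\<Sum>n. ennreal (\<omega> * r n powr (real ?N - 1)))"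
      using I(2) by (intro sum_le_suminf) auto
    also note X(4)
    finally have "(\<Sum>i\<in>I. \<omega> * r i ^ (?N - 1)) < h"
      using \<omega> X(2) by (subst (asm) ennreal_less_iff) (auto intro!: sum_nonneg)
    then have sum_r: "(\<Sum>i\<in>I. r i ^ (?N - 1)) \<le> H"
      using \<omega> by (simp add: H_def field_simps flip: sum_distrib_left)
    have pw: "(2 * r i) ^ ?N = 2 ^ ?N * (r i * r i ^ (?N - 1))" for i
    proof -
      obtain m where "?N = Suc m" using DIM_positive[where 'a='a] gr0_conv_Suc by blast
      then show ?thesis by (simp add: power_mult_distrib)
    qed
    define \<phi> where "\<phi> = bump_cover I X r"
    have sm: "smooth \<phi>" unfolding \<phi>_def by (rule smooth_bump_cover[OF I(2) r0])
    have bd: "0 \<le> \<phi> x" "\<phi> x \<le> 1" for x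
      unfolding \<phi>_def by (rule bump_cover_bounds[OF I(2) r0]; assumption)+
    have [measurable]: "\<phi> \<in> borel_measurable borel"
      by (rule borel_measurable_continuous_onI[OF C_k_continuous[OF smooth_C_k[OF sm]]])
    have nbI: "(\<Union>i\<in>I. cball (X i) (2 * r i)) \<subseteq> nb n"
    proof clarify
      fix i y assume i: "i \<in> I" "y \<in> cball (X i) (2 * r i)"
      then obtain z where z: "z \<in> L" "z \<in> ball (X i) (r i)"
        using I(1) unfolding J_def by blast
      have "infdist y L \<le> dist y z" using z(1) by (rule infdist_le)
      also have "\<dots> \<le> dist y (X i) + dist (X i) z" by (rule dist_triangle)
      also have "\<dots> \<le> 3 * \<delta>" using i(2) z(2) X(3)[of i] by (simp add: dist_commute)
      finally show "y \<in> nb n" by (simp add: nb_def \<delta>_def)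
    qed
    have supp: "supp \<phi> \<subseteq> nb n"
      unfolding \<phi>_def by (rule order_trans[OF supp_bump_cover[OF I(2) r0] nbI])
    have L1: "L1_norm \<phi> \<le> v * H * \<delta>"
    proof -
      have "L1_norm \<phi> \<le> (\<Sum>i\<in>I. unit_ball_vol ?N * (2 * r i) ^ ?N)"
        unfolding \<phi>_def by (rule L1_norm_bump_cover_le[OF I(2) r0])
      also have "\<dots> = (\<Sum>i\<in>I. v * (r i * r i ^ (?N - 1)))" by (simp only: pw v_def mult.assoc)
      also have "\<dots> \<le> (\<Sum>i\<in>I. v * (\<delta> * r i ^ (?N - 1)))"
        using v X(2,3) by (intro sum_mono mult_left_mono mult_right_mono) auto
      also have "\<dots> = v * \<delta> * (\<Sum>i\<in>I. r i ^ (?N - 1))" by (simp add: sum_distrib_left mult.assoc)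
      also have "\<dots> \<le> v * \<delta> * H" using v \<delta> sum_r by (intro mult_left_mono) auto
      finally show ?thesis by (simp add: ac_simps)
    qed
    have L1': "L1_norm_deriv \<phi> \<le> 8 * v * H"
    proof -
      have "L1_norm_deriv \<phi> \<le> (\<Sum>i\<in>I. 8 / r i * (unit_ball_vol ?N * (2 * r i) ^ ?N))"
        unfolding \<phi>_def by (rule L1_norm_deriv_bump_cover_le[OF I(2) r0])
      \<comment> \<open>Dividing the volume by the radius leaves the power that the Hausdorff
        measure counts; in the bound for \<open>L1_norm\<close> the spare radius became
        \<open>\<delta>\<close>.\<close>
      also have "\<dots> = (\<Sum>i\<in>I. 8 * v * r i ^ (?N - 1))"
      proof (rule sum.cong[OF refl])
        fix i assume "i \<in> I"
        then show "8 / r i * (unit_ball_vol ?N * (2 * r i) ^ ?N) = 8 * v * r i ^ (?N - 1)"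
          unfolding pw v_def using r0[of i] by simp
      qed
      also have "\<dots> = 8 * v * (\<Sum>i\<in>I. r i ^ (?N - 1))" by (simp add: sum_distrib_left)
      also have "\<dots> \<le> 8 * v * H" using v sum_r by (intro mult_left_mono) auto
      finally show ?thesis .
    qed
    have Li: "Linf_norm \<phi> \<le> 1" unfolding \<phi>_def by (rule Linf_norm_bump_cover_le[OF I(2) r0])
    have Lm: "L \<in> sets borel" using L(1) by (simp add: compact_imp_closed)
    have "exp (- (1 / 3)) * measure p L = (LINT x|p. exp (- (1 / 3)) * indicator L x)"
      using Lm p(2) by (simp add: sets_eq_imp_space_eq)
    also have "\<dots> \<le> integral\<^sup>L p \<phi>"
    proof (rule integral_mono)
      show "integrable p (\<lambda>x. exp (- (1 / 3)) * indicator L x :: real)"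
        using Lm p(2) by (intro integrable_mult_right) (auto simp: integrable_indicator_iff p.emeasure_eq_measure)
      show "integrable p \<phi>" using bd by (intro p.integrable_const_bound[where B = 1]) auto
      show "exp (- (1 / 3)) * indicator L x \<le> \<phi> x" for x
      proof (cases "x \<in> L")
        case True
        then obtain i where "i \<in> I" "x \<in> ball (X i) (r i)" using I(3) by blast
        then have "exp (- (1 / 3)) \<le> \<phi> x" unfolding \<phi>_def by (intro bump_cover_ge[OF I(2) r0])
        then show ?thesis using True by simp
      qed (use bd in simp)
    qed
    also have "\<dots> \<le> integral\<^sup>L q \<phi> + (C * L1_norm \<phi> + \<epsilon> * (L1_norm_deriv \<phi> + Linf_norm \<phi>))"
      using C(2)[OF sm] supp nb_antimono[of 0 n] by (auto simp: algebra_simps)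
    also have "C * L1_norm \<phi> + \<epsilon> * (L1_norm_deriv \<phi> + Linf_norm \<phi>) \<le> C * (v * H * \<delta>) + \<epsilon> * (8 * v * H + 1)"
      using C(1) \<epsilon>(1) L1 L1' Li by (intro add_mono mult_left_mono) auto
    also have "\<dots> \<le> e / 3 + e / 3"
      using n(2) \<epsilon>(2) by (simp add: \<delta>_def mult.assoc)
    also have "integral\<^sup>L q \<phi> \<le> (LINT x|q. indicator (nb n) x)"
    proof (rule integral_mono)
      show "integrable q \<phi>" using bd by (intro q.integrable_const_bound[where B = 1]) auto
      show "integrable q (\<lambda>x. indicator (nb n) x :: real)"
        using nb_closed[of n] q(2) by (auto simp: integrable_indicator_iff q.emeasure_eq_measure)
      show "\<phi> x \<le> indicator (nb n) x" for x
        using bd[of x] supp closure_subset[of "{x. \<phi> x \<noteq> 0}"] unfolding supp_def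
        by (cases "x \<in> nb n") auto
    qed
    also have "\<dots> = measure q (nb n)" using nb_closed[of n] q(2) by (simp add: sets_eq_imp_space_eq)
    finally show "exp (- (1 / 3)) * measure p L \<le> measure q L + e" using n(1) by simp
  qed
qed simp

section \<open>Charges and sets of finite Hausdorff measure\<close>

lemma signed_integral_uminus: "signed_integral (\<lambda>A. - \<mu> A) f = - signed_integral \<mu> f"
  by (simp add: signed_integral_def neg_part_measure_def)

lemma charge_uminus: "charge \<mu> \<Longrightarrow> charge (\<lambda>A. - \<mu> A)"
  by (simp add: charge_def signed_integral_uminus)

text \<open>A set \<open>B \<subseteq> A\<close> on which \<open>\<mu>\<close> nearly attains the positive variation of \<open>A\<close> has small
  negative variation; this replaces a Hahn decomposition.\<close>

lemma pos_part_null_of_charge: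
  fixes \<mu> :: "'a::euclidean_space set \<Rightarrow> real"
  assumes \<mu>: "finite_signed_borel_measure \<mu>" and charge: "charge \<mu>"
    and A: "A \<in> sets borel" "hausdorff_measure (real DIM('a) - 1) A < \<infinity>"
  shows "measure (pos_part_measure \<mu>) A = 0"
proof (rule ccontr)
  note \<mu>' = finite_signed_borel_measure_uminus[OF \<mu>]
  define p where "p = pos_part_measure \<mu>"
  define q where "q = neg_part_measure \<mu>"
  have p: "finite_measure p" "sets p = sets borel" and q: "finite_measure q" "sets q = sets borel"
    unfolding p_def q_def neg_part_measure_def
    by (simp_all add: finite_measure_pos_part_measure sets_pos_part_measure \<mu> \<mu>')
  interpret p: finite_measure p by fact
  interpret q: finite_measure q by fact
  assume "measure (pos_part_measure \<mu>) A \<noteq> 0"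
  then have pos: "measure p A > 0" by (simp add: p_def zero_less_measure_iff)
  define c :: real where "c = exp (- (1 / 3))"
  have c: "0 < c" "c \<le> 1" by (auto simp: c_def)
  \<comment> \<open>With the quarter, \<open>c * measure p L\<close> exceeds
    \<open>4 * \<eta> - 2 * (c * \<eta>)\<close>, hence \<open>2 * \<eta>\<close>, while
    \<open>measure q L\<close> stays below \<open>\<eta>\<close>.\<close>
  define \<eta> where "\<eta> = c * measure p A / 4"
  have \<eta>: "\<eta> > 0" using c pos by (simp add: \<eta>_def)
  obtain B where B: "B \<in> sets borel" "B \<subseteq> A" "\<mu> B > measure p A - \<eta>"
  proof (rule ccontr)
    assume "\<not> thesis"
    then have *: "\<mu> B \<le> measure p A - \<eta>" if "B \<in> sets borel" "B \<subseteq> A" for B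
      using that \<open>\<And>B. \<lbrakk>B \<in> sets borel; B \<subseteq> A; measure p A - \<eta> < \<mu> B\<rbrakk> \<Longrightarrow> thesis\<close> by (meson not_le)
    have "0 \<le> measure p A - \<eta>"
      using *[of "{}"] signed_measure_empty[OF \<mu>] by simp
    then have "measure p A \<le> measure p A - \<eta>"
      unfolding p_def using * by (intro measure_pos_part_le[OF \<mu> A(1)]) (auto simp: p_def)
    then show False using \<eta> by simp
  qed
  have dec: "\<mu> B = measure p B - measure q B"
    unfolding p_def q_def by (rule Jordan_decomposition[OF \<mu> B(1)])
  have pB: "measure p B \<le> measure p A"
    using B A(1) p(2) by (intro p.finite_measure_mono) auto
  have qB: "measure q B < \<eta>" using dec pB B(3) by linarith
  \<comment> \<open>Inner regularity replaces \<open>B\<close> by a compact set, for which finite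
    subcovers are available.\<close>
  have "emeasure p B = (SUP K\<in>{K. K \<subseteq> B \<and> compact K}. emeasure p K)"
    using p B(1) by (intro inner_regular) (auto simp: p.emeasure_eq_measure)
  moreover have "ennreal (measure p B - \<eta>) < emeasure p B"
  proof -
    have "\<eta> \<le> measure p A / 4" using c pos by (simp add: \<eta>_def mult_left_le_one_le)
    then have "measure p B > 0" using dec B(3) pos measure_nonneg[of q B] by linarith
    then show ?thesis using \<eta> by (simp add: p.emeasure_eq_measure ennreal_lessI)
  qed
  ultimately have "ennreal (measure p B - \<eta>) < (SUP K\<in>{K. K \<subseteq> B \<and> compact K}. emeasure p K)" by simp
  then obtain L where L: "L \<subseteq> B" "compact L" "ennreal (measure p B - \<eta>) < emeasure p L"
    by (subst (asm) less_SUP_iff) blast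
  have pL: "measure p L > measure p B - \<eta>"
    using L(3) by (metis ennreal_leI not_le p.emeasure_eq_measure)
  have qL: "measure q L \<le> measure q B"
    using L B(1) q(2) by (intro q.finite_measure_mono) auto
  have "c * measure p L \<le> measure q L"
    unfolding c_def
  proof (rule measure_le_of_charge_estimate[OF p q _ L(2)])
    show "hausdorff_measure (real DIM('a) - 1) L < \<infinity>"
      using hausdorff_measure_mono[of L A] L(1) B(2) A(2) by (meson le_less_trans order_trans)
    fix \<epsilon> :: real and K :: "'a set" assume "\<epsilon> > 0" "compact K"
    then obtain C where "C > 0" "\<And>\<phi>. smooth \<phi> \<Longrightarrow> supp \<phi> \<subseteq> K \<Longrightarrow>
      \<bar>signed_integral \<mu> \<phi>\<bar> \<le> C * L1_norm \<phi> + \<epsilon> * (L1_norm_deriv \<phi> + Linf_norm \<phi>)"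
      using charge unfolding charge_def by blast
    then show "\<exists>C>0. \<forall>\<phi>. smooth \<phi> \<longrightarrow> supp \<phi> \<subseteq> K \<longrightarrow>
      integral\<^sup>L p \<phi> - integral\<^sup>L q \<phi> \<le> C * L1_norm \<phi> + \<epsilon> * (L1_norm_deriv \<phi> + Linf_norm \<phi>)"
      unfolding signed_integral_def p_def q_def by (meson abs_le_D1)
  qed
  moreover have "c * (measure p A - 2 * \<eta>) < c * measure p L"
    using c pL dec B(3) qB measure_nonneg[of q B] by (intro mult_strict_left_mono) linarith+
  moreover have "c * (measure p A - 2 * \<eta>) = 4 * \<eta> - 2 * (c * \<eta>)" by (simp add: \<eta>_def algebra_simps)
  moreover have "c * \<eta> \<le> \<eta>" using c \<eta> by (simp add: mult_left_le_one_le)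
  ultimately show False using qL qB \<eta> by linarith
qed

text \<open>Finite Hausdorff measure passes to subsets, so both parts of the Jordan decomposition
  vanish on the Borel sets in question. The integral estimate applies to each part with half of
  \<open>\<epsilon>\<close>.\<close>

lemma charge_of_hausdorff_null:
  fixes \<mu> :: "'a::euclidean_space set \<Rightarrow> real"
  assumes \<mu>: "finite_signed_borel_measure \<mu>"
    and null: "\<And>A. A \<in> sets borel \<Longrightarrow> hausdorff_measure (real DIM('a) - 1) A < \<infinity> \<Longrightarrow> \<mu> A = 0"
  shows "charge \<mu>"
  unfolding charge_def
proof (intro allI impI)
  note \<mu>' = finite_signed_borel_measure_uminus[OF \<mu>]
  fix \<epsilon> :: real and K :: "'a set" assume \<epsilon>: "\<epsilon> > 0" and K: "compact K"
  have null': "\<mu> B = 0" if "A \<in> sets borel" "hausdorff_measure (real DIM('a) - 1) A < \<infinity>" "B \<in> sets borel" "B \<subseteq> A" for A B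
    using that hausdorff_measure_mono[OF that(4)] by (intro null) (auto intro: le_less_trans)
  have "\<exists>C>0. \<forall>\<phi>. smooth \<phi> \<longrightarrow> compact (supp \<phi>) \<longrightarrow>
      \<bar>integral\<^sup>L (pos_part_measure \<mu>) \<phi>\<bar> \<le> C * L1_norm \<phi> + \<epsilon> / 2 * (L1_norm_deriv \<phi> + Linf_norm \<phi>)"
    using \<epsilon> null'
    by (intro integral_le_of_hausdorff_null finite_measure_pos_part_measure sets_pos_part_measure \<mu>)
      (auto simp: emeasure_pos_part_measure[OF \<mu>] SUP_eq_iff intro!: antisym SUP_least)
  then obtain C1 where C1: "C1 > 0" "\<And>\<phi>. smooth \<phi> \<Longrightarrow> compact (supp \<phi>) \<Longrightarrow>
      \<bar>integral\<^sup>L (pos_part_measure \<mu>) \<phi>\<bar> \<le> C1 * L1_norm \<phi> + \<epsilon> / 2 * (L1_norm_deriv \<phi> + Linf_norm \<phi>)"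
    by blast
  have "\<exists>C>0. \<forall>\<phi>. smooth \<phi> \<longrightarrow> compact (supp \<phi>) \<longrightarrow>
      \<bar>integral\<^sup>L (neg_part_measure \<mu>) \<phi>\<bar> \<le> C * L1_norm \<phi> + \<epsilon> / 2 * (L1_norm_deriv \<phi> + Linf_norm \<phi>)"
    unfolding neg_part_measure_def using \<epsilon> null'
    by (intro integral_le_of_hausdorff_null finite_measure_pos_part_measure sets_pos_part_measure \<mu>')
      (auto simp: emeasure_pos_part_measure[OF \<mu>'] SUP_eq_iff intro!: antisym SUP_least)
  then obtain C2 where C2: "C2 > 0" "\<And>\<phi>. smooth \<phi> \<Longrightarrow> compact (supp \<phi>) \<Longrightarrow>
      \<bar>integral\<^sup>L (neg_part_measure \<mu>) \<phi>\<bar> \<le> C2 * L1_norm \<phi> + \<epsilon> / 2 * (L1_norm_deriv \<phi> + Linf_norm \<phi>)"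
    by blast
  have "\<bar>signed_integral \<mu> \<phi>\<bar> \<le> (C1 + C2) * L1_norm \<phi> + \<epsilon> * (L1_norm_deriv \<phi> + Linf_norm \<phi>)"
    if \<phi>: "smooth \<phi>" "supp \<phi> \<subseteq> K" for \<phi>
  proof -
    have "compact (supp \<phi>)"
      using compact_Int_closed[OF K, of "supp \<phi>"] \<phi>(2) by (simp add: supp_def inf_absorb2)
    define D where "D = L1_norm_deriv \<phi> + Linf_norm \<phi>"
    have "\<bar>integral\<^sup>L (pos_part_measure \<mu>) \<phi>\<bar> \<le> C1 * L1_norm \<phi> + \<epsilon> / 2 * D"
      "\<bar>integral\<^sup>L (neg_part_measure \<mu>) \<phi>\<bar> \<le> C2 * L1_norm \<phi> + \<epsilon> / 2 * D"
      unfolding D_def using C1(2) C2(2) \<phi>(1) \<open>compact (supp \<phi>)\<close> by blast+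
    then have "\<bar>signed_integral \<mu> \<phi>\<bar> \<le> C1 * L1_norm \<phi> + \<epsilon> / 2 * D + (C2 * L1_norm \<phi> + \<epsilon> / 2 * D)"
      unfolding signed_integral_def by linarith
    then show ?thesis by (simp add: D_def field_simps)
  qed
  then show "\<exists>C>0. \<forall>\<phi>. smooth \<phi> \<longrightarrow> supp \<phi> \<subseteq> K \<longrightarrow>
      \<bar>signed_integral \<mu> \<phi>\<bar> \<le> C * L1_norm \<phi> + \<epsilon> * (L1_norm_deriv \<phi> + Linf_norm \<phi>)"
    using C1(1) C2(1) by (intro exI[of _ "C1 + C2"]) auto
qed

theorem corollary1p5:
  fixes \<mu> :: "(real ^ 'n) set \<Rightarrow> real"
  assumes "finite_signed_borel_measure \<mu>"
  shows "charge \<mu> \<longleftrightarrow>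
    (\<forall>A \<in> sets borel. hausdorff_measure (real CARD('n) - 1) A < \<infinity> \<longrightarrow> \<mu> A = 0)"
proof
  have dim: "DIM(real ^ 'n) = CARD('n)" by simp
  show "\<forall>A \<in> sets borel. hausdorff_measure (real CARD('n) - 1) A < \<infinity> \<longrightarrow> \<mu> A = 0" if "charge \<mu>"
  proof (intro ballI impI)
    fix A :: "(real ^ 'n) set"
    assume A: "A \<in> sets borel" "hausdorff_measure (real CARD('n) - 1) A < \<infinity>"
    have "measure (pos_part_measure \<mu>) A = 0"
      by (rule pos_part_null_of_charge[OF assms that A(1)]) (use A(2) in simp)
    \<comment> \<open>The negative part of \<open>\<mu>\<close> is the positive part of its
      negative, which is again a charge.\<close>
    moreover have "measure (pos_part_measure (\<lambda>A. - \<mu> A)) A = 0"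
      by (rule pos_part_null_of_charge[OF finite_signed_borel_measure_uminus[OF assms] charge_uminus[OF that] A(1)])
        (use A(2) in simp)
    ultimately show "\<mu> A = 0"
      using Jordan_decomposition[OF assms A(1)] by (simp add: neg_part_measure_def)
  qed
  show "charge \<mu>" if "\<forall>A \<in> sets borel. hausdorff_measure (real CARD('n) - 1) A < \<infinity> \<longrightarrow> \<mu> A = 0"
    by (rule charge_of_hausdorff_null[OF assms]) (use that in simp)
qed

end
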